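(* Let the ILRFPP model on $\mathbb{Z}^d$ satisfy the standing assumptions, and suppose $$\frac d\theta<\alpha<\frac{2d}{\theta}\qquad\text{and}\qquad\alpha>\frac{2d}{\gamma}.$$ Set $\Delta:=\dfrac{\log2}{\log\big(2d/(\alpha\theta)\big)}\in(1,\infty)$. Fix $x\in\mathbb{R}^d$ with $\|x\|_\infty\le1$, $x\neq0$, and let $T_n:=T(0,\lceil nx\rceil)$. Then for every $\varepsilon>0$ there is $C<\infty$ with $$\mathbb{P}\big(T_n>C(\log n)^{\Delta+\varepsilon}\big)\xrightarrow[n\to\infty]{}0.$$
   Context: Model (inhomogeneous long-range first-passage percolation, ILRFPP). Fix an integer $d\ge1$ and $\alpha>0$; $\|\cdot\|$ is the $\ell_1$ norm on $\mathbb{Z}^d$. The vertex weights $(V_x)_{x\in\mathbb{Z}^d}$ are i.i.d. with the law of a random variable $V$; the edge noises $\omega_{xy}=\omega_{yx}\ge0$, one for every unordered pair $\{x,y\}$ of distinct vertices of $\mathbb{Z}^d$ (all pairs are edges), are i.i.d. with the law of $\omega$, and independent of the vertex weights. The passage time of an edge is $W_{xy}:=\|x-y\|^{\alpha}\,\omega_{xy}/(V_xV_y)$. A path is a finite sequence of distinct vertices; its passage time is the sum of $W$ over its consecutive edges. $T(x,y)$ is the infimum of the passage times over all finite self-avoiding paths from $x$ to $y$. $\lceil nx\rceil$ is the coordinatewise ceiling. Standing assumptions: for fixed $\gamma,\theta,\zeta>0$, $\mathbb{P}(0<V<\infty)=1$ and $\lim_{x\to\infty}\log\mathbb{P}(V\ge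 x)/\log x=-\gamma$; $\lim_{x\downarrow0}\log\mathbb{P}(\omega\le x)/\log x=\theta$ and $\mathbb{E}\,\omega^{\zeta}<\infty$. *)

theory Defs
  imports "HOL-Probability.Probability"
begin

type_synonym 'd site = "int ^ 'd"

definition l1_norm :: "'d::finite site \<Rightarrow> real" where
  "l1_norm x = (\<Sum>i\<in>UNIV. \<bar>real_of_int (x $ i)\<bar>)"

definition ceil_vec :: "real ^ 'd::finite \<Rightarrow> 'd site" where
  "ceil_vec z = (\<chi> i. \<lceil>z $ i\<rceil>)"

definition edges :: "'d::finite site set set" where
  "edges = {{x, y} |x y. x \<noteq> y}"

definition edge_time ::
  "real \<Rightarrow> ('d::finite site \<Rightarrow> 's \<Rightarrow> real) \<Rightarrow> ('d site set \<Rightarrow> 's \<Rightarrow> real) \<Rightarrow> 's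
    \<Rightarrow> 'd site \<Rightarrow> 'd site \<Rightarrow> real" where
  "edge_time \<alpha> V \<omega> s x y = l1_norm (x - y) powr \<alpha> * \<omega> {x, y} s / (V x s * V y s)"

definition paths :: "'d::finite site \<Rightarrow> 'd site \<Rightarrow> 'd site list set" where
  "paths x y = {p. p \<noteq> [] \<and> distinct p \<and> hd p = x \<and> last p = y}"

definition path_time ::
  "real \<Rightarrow> ('d::finite site \<Rightarrow> 's \<Rightarrow> real) \<Rightarrow> ('d site set \<Rightarrow> 's \<Rightarrow> real) \<Rightarrow> 's
    \<Rightarrow> 'd site list \<Rightarrow> real" where
  "path_time \<alpha> V \<omega> s p = (\<Sum>i<length p - 1. edge_time \<alpha> V \<omega> s (p ! i) (p ! Suc i))"

text \<open>The infimum is taken in the extended reals, so that it is also meaningful (and measurable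
  in \<open>s\<close>) on the null event where some weight \<open>V x\<close> is not positive or some noise is negative.\<close>

definition passage_time ::
  "real \<Rightarrow> ('d::finite site \<Rightarrow> 's \<Rightarrow> real) \<Rightarrow> ('d site set \<Rightarrow> 's \<Rightarrow> real) \<Rightarrow> 's
    \<Rightarrow> 'd site \<Rightarrow> 'd site \<Rightarrow> ereal" where
  "passage_time \<alpha> V \<omega> s x y = (INF p\<in>paths x y. ereal (path_time \<alpha> V \<omega> s p))"

text \<open>\<open>\<mu>\<close> is the law of the generic vertex weight and \<open>\<nu>\<close> the law of the generic edge noise.
  Independence is that of the one family consisting of all vertex weights and all edge noises.
  The values of \<open>\<omega>\<close> on sets that are not edges are irrelevant.\<close>

locale ilrfpp = prob_space M
  for M :: "'s measure" +
  fixes V :: "'d::finite site \<Rightarrow> 's \<Rightarrow> real"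
    and \<omega> :: "'d site set \<Rightarrow> 's \<Rightarrow> real"
    and \<mu> \<nu> :: "real measure"
    and \<alpha> :: real
  assumes alpha_pos: "\<alpha> > 0"
    and indep: "indep_vars (\<lambda>_. borel) (case_sum V \<omega>) (UNIV <+> edges)"
    and law_V: "\<And>x. distr M borel (V x) = \<mu>"
    and law_omega: "\<And>e. e \<in> edges \<Longrightarrow> distr M borel (\<omega> e) = \<nu>"
    and omega_nonneg: "AE w in \<nu>. 0 \<le> w"

text \<open>In Isabelle/HOL \<open>ln 0 = 0\<close>, whereas the usual convention is \<open>log 0 = -\<infinity>\<close>. This does not
  change the two limit conditions: as \<open>\<gamma>\<close> and \<open>\<theta>\<close> are nonzero and finite, under either
  convention they force the probabilities to be eventually positive.\<close>

locale ilrfpp_standing = ilrfpp M V \<omega> \<mu> \<nu> \<alpha>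
  for M :: "'s measure"
    and V :: "'d::finite site \<Rightarrow> 's \<Rightarrow> real"
    and \<omega> :: "'d site set \<Rightarrow> 's \<Rightarrow> real"
    and \<mu> \<nu> :: "real measure"
    and \<alpha> :: real +
  fixes \<gamma> \<theta> \<zeta> :: real
  assumes gamma_pos: "\<gamma> > 0" and theta_pos: "\<theta> > 0" and zeta_pos: "\<zeta> > 0"
    and V_pos: "measure \<mu> {0<..} = 1"
    and V_tail: "((\<lambda>x. ln (measure \<mu> {x..}) / ln x) \<longlongrightarrow> - \<gamma>) at_top"
    and omega_near_0: "((\<lambda>x. ln (measure \<nu> {..x}) / ln x) \<longlongrightarrow> \<theta>) (at_right 0)"
    and omega_moment: "integrable \<nu> (\<lambda>w. w powr \<zeta>)"

end

theory Submission
  imports Defs "HOL-Real_Asymp.Real_Asymp"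
begin

text \<open>
  Only edges between vertices of weight at least a constant \<open>v\<^sub>0\<close> are used, apart from the two
  endpoints. An edge of length about \<open>L\<close> between such vertices is crossed in bounded time as soon
  as its noise is at most \<open>L powr - \<alpha>\<close>, which has probability about \<open>L powr - (\<alpha> * \<theta>)\<close>. These fast
  edges form a long-range percolation graph with exponent \<open>\<alpha> * \<theta>\<close> between \<open>d\<close> and \<open>2 * d\<close>, and the
  proof follows the hierarchical construction of short paths in such graphs.

  Let \<open>1 < b < 2 * d / (\<alpha> * \<theta>)\<close>. Two cubes of side \<open>r\<close> at distance about \<open>r powr b\<close> have \<open>r powr (2 * d)\<close>
  pairs of points between them, so that many fast edges are expected: about
  \<open>r powr (2 * d - b * \<alpha> * \<theta>)\<close>. Hence two points at distance \<open>r powr b\<close> can be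
  joined by one fast edge, after which two gaps of size \<open>r\<close> remain, one at each end. The recursion is
  iterated down from \<open>n = R powr (b ^ M)\<close> until the gaps have size \<open>R\<close>, a small power of \<open>ln n\<close>; a gap
  of that size is crossed by two edges through one of \<open>R\<close> many intermediate vertices. Since
  \<open>b ^ M \<le> ln n\<close>, the path has about \<open>2 ^ M \<le> ln n powr (ln 2 / ln b)\<close> edges, and
  \<open>ln 2 / ln b\<close> is as close to \<open>\<Delta>\<close> as desired (the definition \<open>linked\<close> and the lemma \<open>passage_time_le\<close>).

  The endpoints of the gaps are themselves random, being the ends of fast edges found before. This is dealt
  with by recursing on a supremum over deterministic pairs: let \<open>q k\<close> bound the probability that a
  fixed pair at scale \<open>k\<close> is not linked. By Markov's inequality,
  except with probability \<open>4 * q k\<close> at least three quarters of the candidate points near \<open>u\<close> are linked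
  to \<open>u\<close>; most candidates are also of weight at least \<open>v\<^sub>0\<close>, and the same holds near \<open>v\<close>. These two
  random sets of good candidates depend only on vertex weights and on edges inside two disjoint
  cubes, and so are independent of the edges between the cubes. Therefore some good pair is joined by a fast
  edge up to a stretched exponentially small error \<open>err\<close>, which gives
  \<open>q (k + 1) \<le> 8 * q k + 2 * err\<close> (lemma \<open>not_linked_Suc_cover\<close>). The factor \<open>8 ^ M\<close>
  accumulated in this way is a power of \<open>ln n\<close>, whereas \<open>err\<close> is stretched exponentially small in \<open>ln n\<close>.
\<close>

section \<open>Passage times along paths\<close>

lemma l1_norm_le:
  assumes "\<And>i. \<bar>real_of_int (w $ i)\<bar> \<le> c"
  shows "l1_norm (w :: 'd::finite site) \<le> real CARD('d) * c"
  unfolding l1_norm_def using sum_bounded_above[of UNIV "\<lambda>i. \<bar>real_of_int (w $ i)\<bar>" c] assms by simp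

lemma l1_norm_nonneg: "0 \<le> l1_norm w"
  unfolding l1_norm_def by (simp add: sum_nonneg)

lemma l1_norm_minus_commute: "l1_norm (x - y) = l1_norm (y - x)"
  unfolding l1_norm_def by (simp add: abs_minus_commute)

lemma edge_time_commute: "edge_time \<alpha> V \<omega> s x y = edge_time \<alpha> V \<omega> s y x"
  unfolding edge_time_def by (simp add: l1_norm_minus_commute[of x y] insert_commute mult.commute)

lemma edge_time_le:
  assumes "0 < m" "m \<le> V x s" "m \<le> V y s" "\<omega> {x, y} s \<le> c" "l1_norm (x - y) \<le> L" "0 \<le> c" "0 < \<alpha>"
  shows "edge_time \<alpha> V \<omega> s x y \<le> L powr \<alpha> * c / m\<^sup>2"
proof -
  have m2: "m\<^sup>2 \<le> V x s * V y s"
    using assms(1-3) by (simp add: power2_eq_square mult_mono)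
  have "l1_norm (x - y) powr \<alpha> * \<omega> {x, y} s \<le> l1_norm (x - y) powr \<alpha> * c"
    using assms by (intro mult_left_mono) auto
  also have "\<dots> \<le> L powr \<alpha> * c"
    using assms l1_norm_nonneg[of "x - y"] by (intro mult_right_mono powr_mono2) auto
  finally have *: "l1_norm (x - y) powr \<alpha> * \<omega> {x, y} s \<le> L powr \<alpha> * c" .
  have "edge_time \<alpha> V \<omega> s x y \<le> L powr \<alpha> * c / (V x s * V y s)"
    unfolding edge_time_def using assms m2 by (intro divide_right_mono *) (simp add: mult_nonneg_nonneg)
  also have "\<dots> \<le> L powr \<alpha> * c / m\<^sup>2"
    using m2 assms by (intro divide_left_mono mult_pos_pos) (auto)
  finally show ?thesis .
qed

lemma path_time_Cons_Cons:
  "path_time \<alpha> V \<omega> s (x # y # p) = edge_time \<alpha> V \<omega> s x y + path_time \<alpha> V \<omega> s (y # p)"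
  unfolding path_time_def by (simp add: sum.lessThan_Suc_shift del: sum.lessThan_Suc)

lemma path_time_singleton: "path_time \<alpha> V \<omega> s [x] = 0"
  unfolding path_time_def by simp

lemma path_time_append:
  assumes "p \<noteq> []" "q \<noteq> []"
  shows "path_time \<alpha> V \<omega> s (p @ q)
    = path_time \<alpha> V \<omega> s p + edge_time \<alpha> V \<omega> s (last p) (hd q) + path_time \<alpha> V \<omega> s q"
  using assms(1)
proof (induction p rule: induct_list012)
  case (2 x)
  with assms(2) show ?case
    by (cases q) (auto simp: path_time_Cons_Cons path_time_singleton)
next
  case (3 x y zs)
  then show ?case by (auto simp: path_time_Cons_Cons)
qed auto

lemma path_time_rev: "path_time \<alpha> V \<omega> s (rev p) = path_time \<alpha> V \<omega> s p"
proof (induction p rule: induct_list012)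
  case (3 x y zs)
  have "path_time \<alpha> V \<omega> s (rev (x # y # zs)) = path_time \<alpha> V \<omega> s (rev (y # zs) @ [x])" by simp
  also have "\<dots> = path_time \<alpha> V \<omega> s (rev (y # zs)) + edge_time \<alpha> V \<omega> s y x"
    by (subst path_time_append) (auto simp: last_rev path_time_singleton)
  finally show ?case using 3 by (simp add: path_time_Cons_Cons edge_time_commute[of _ _ _ _ x])
qed (auto simp: path_time_def)

section \<open>Lattice boxes and the number of bad points\<close>

lemma ceil_vec_nth: "ceil_vec z $ i = \<lceil>z $ i\<rceil>"
  unfolding ceil_vec_def by simp

lemma ceil_vec_le:
  assumes "infnorm x \<le> 1"
  shows "\<bar>ceil_vec (real n *\<^sub>R x) $ i\<bar> \<le> int n"
proof -
  have "\<bar>x $ i\<bar> \<le> 1"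
    using component_le_infnorm_cart[of x i] assms by simp
  then have "\<bar>real n * x $ i\<bar> \<le> real n"
    by (simp add: abs_mult mult_left_le)
  then show ?thesis unfolding ceil_vec_nth by (simp add: abs_le_iff) linarith
qed

lemma card_box:
  fixes A :: "'d::finite \<Rightarrow> int set"
  assumes "\<And>i. finite (A i)"
  shows "finite {w :: 'd site. \<forall>i. w $ i \<in> A i}" (is "finite ?B")
    and "card {w :: 'd site. \<forall>i. w $ i \<in> A i} = (\<Prod>i\<in>UNIV. card (A i))"
proof -
  have B: "?B = vec_lambda ` PiE UNIV A"
  proof (intro set_eqI iffI)
    fix w assume "w \<in> ?B"
    then have "w = vec_lambda (vec_nth w)" "vec_nth w \<in> PiE UNIV A" by auto
    then show "w \<in> vec_lambda ` PiE UNIV A" by blast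
  qed auto
  show "finite ?B" unfolding B using assms by (intro finite_imageI finite_PiE) auto
  have "inj_on vec_lambda (PiE UNIV A)" by (rule inj_onI) (simp add: vec_lambda_inject)
  then show "card ?B = (\<Prod>i\<in>UNIV. card (A i))"
    unfolding B by (simp add: card_image card_PiE)
qed

context prob_space begin

text \<open>A first moment bound is the right tool for linkage events around a common centre, which depend on
  each other in a complicated way.\<close>

lemma prob_many_bad_le:
  fixes B :: "'i \<Rightarrow> 'a set"
  assumes "finite S" "S \<noteq> {}" "\<And>i. i \<in> S \<Longrightarrow> B i \<in> events" "\<And>i. i \<in> S \<Longrightarrow> prob (B i) \<le> q"
  shows "prob {s \<in> space M. real (card S) \<le> 4 * real (card {i \<in> S. s \<in> B i})} \<le> 4 * q"
proof -
  let ?f = "\<lambda>s. \<Sum>i\<in>S. indicator (B i) s :: real"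
  have f: "?f s = real (card {i \<in> S. s \<in> B i})" for s
    using assms(1) by (simp add: indicator_def sum.If_cases Int_def)
  have int: "integrable M ?f"
    using assms(3) by (intro Bochner_Integration.integrable_sum integrable_indicator) (auto simp: emeasure_eq_measure)
  have pos: "0 < card S" using assms by (simp add: card_gt_0_iff)
  have "prob {s \<in> space M. real (card S) / 4 \<le> ?f s} \<le> (\<integral>s. ?f s \<partial>M) / (real (card S) / 4)"
    using pos by (intro integral_Markov_inequality_measure[OF int, where A="{}"]) (auto intro!: sum_nonneg)
  also have "(\<integral>s. ?f s \<partial>M) = (\<Sum>i\<in>S. prob (B i))"
    using assms(3) by (subst Bochner_Integration.integral_sum) (auto simp: emeasure_eq_measure Int_absorb1 sets.sets_into_space intro!: sum.cong integrable_indicator)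
  also have "(\<Sum>i\<in>S. prob (B i)) / (real (card S) / 4) \<le> (\<Sum>i\<in>S. q) / (real (card S) / 4)"
    using assms(4) by (intro divide_right_mono sum_mono) auto
  also have "\<dots> = 4 * q" using pos by simp
  finally show ?thesis unfolding f by (simp add: mult.commute)
qed

end

section \<open>Independence of disjoint blocks of weights and noises\<close>

context ilrfpp begin

text \<open>Its sigma-algebra consists of the events that can be decided from the weights (index \<open>Inl x\<close>) and noises
  (index \<open>Inr e\<close>) in \<open>J\<close>; it is wrapped as a measure so that measurability proofs can be automated.\<close>

definition info :: "('d site + 'd site set) set \<Rightarrow> 's measure" where
  "info J = sigma (space M) (\<Union>i\<in>J. {case_sum V \<omega> i -` B \<inter> space M |B. B \<in> sets borel})"

lemma space_info [simp]: "space (info J) = space M"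
  unfolding info_def by (rule space_measure_of) auto

lemma sets_info: "sets (info J)
    = sigma_sets (space M) (\<Union>i\<in>J. {case_sum V \<omega> i -` B \<inter> space M |B. B \<in> sets borel})"
  unfolding info_def by (rule sets_measure_of) auto

lemma measurable_info: "i \<in> J \<Longrightarrow> case_sum V \<omega> i \<in> borel_measurable (info J)"
  by (rule measurableI) (auto simp: sets_info intro!: sigma_sets.Basic)

lemma V_measurable_info: "Inl x \<in> J \<Longrightarrow> V x \<in> borel_measurable (info J)"
  using measurable_info[of "Inl x" J] by simp

lemma omega_measurable_info: "Inr e \<in> J \<Longrightarrow> \<omega> e \<in> borel_measurable (info J)"
  using measurable_info[of "Inr e" J] by simp

text \<open>The form in which independence is used throughout: data with indices in disjoint sets are independent.
  Intersecting with \<open>space M\<close> gives the right value for \<open>K = {}\<close>.\<close>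

lemma prob_blocks:
  fixes I :: "'j \<Rightarrow> ('d site + 'd site set) set"
  assumes "finite K" "disjoint_family_on I K" "(\<Union>j\<in>K. I j) \<subseteq> UNIV <+> edges"
    and "\<And>j. j \<in> K \<Longrightarrow> A j \<in> sets (info (I j))"
  shows "prob (space M \<inter> (\<Inter>j\<in>K. A j)) = (\<Prod>j\<in>K. prob (A j))"
proof (cases "K = {}")
  case False
  let ?E = "\<lambda>i. {case_sum V \<omega> i -` B \<inter> space M |B. B \<in> sets borel}"
  have "indep_sets ?E (UNIV <+> edges)"
    using indep unfolding indep_vars_def2 by blast
  then have "indep_sets ?E (\<Union>j\<in>K. I j)"
    by (rule indep_sets_mono_index[OF assms(3)])
  moreover have "Int_stable (?E i)" for i
  proof (rule Int_stableI)
    fix a c assume "a \<in> ?E i" "c \<in> ?E i"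
    then obtain B C where B: "a = case_sum V \<omega> i -` B \<inter> space M" "B \<in> sets borel"
      and C: "c = case_sum V \<omega> i -` C \<inter> space M" "C \<in> sets borel" by blast
    then have "a \<inter> c = case_sum V \<omega> i -` (B \<inter> C) \<inter> space M" "B \<inter> C \<in> sets borel" by auto
    then show "a \<inter> c \<in> ?E i" by blast
  qed
  ultimately have "indep_sets (\<lambda>j. sigma_sets (space M) (\<Union>i\<in>I j. ?E i)) K"
    using assms(2) by (intro indep_sets_collect_sigma) auto
  then have "prob (\<Inter>j\<in>K. A j) = (\<Prod>j\<in>K. prob (A j))"
    using False assms by (intro indep_setsD) (auto simp: sets_info)
  moreover have "A j \<subseteq> space M" if "j \<in> K" for j
    using sets.sets_into_space[OF assms(4)[OF that]] by simp
  then have "space M \<inter> (\<Inter>j\<in>K. A j) = (\<Inter>j\<in>K. A j)"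
    using False by blast
  ultimately show ?thesis by simp
qed (simp add: prob_space)

lemma V_measurable [measurable]: "V x \<in> borel_measurable M"
  using indep unfolding indep_vars_def2 by (force dest: bspec[of _ _ "Inl x"])

lemma omega_measurable [measurable]: "e \<in> edges \<Longrightarrow> \<omega> e \<in> borel_measurable M"
  using indep unfolding indep_vars_def2 by (force dest: bspec[of _ _ "Inr e"])

lemma sets_info_le:
  assumes "J \<subseteq> UNIV <+> edges"
  shows "sets (info J) \<subseteq> events"
proof -
  have "case_sum V \<omega> i \<in> borel_measurable M" if "i \<in> J" for i
    using that assms indep unfolding indep_vars_def2 by blast
  then show ?thesis unfolding sets_info
    by (intro sets.sigma_sets_subset) (auto intro!: measurable_sets)
qed

lemma prob_V: "B \<in> sets borel \<Longrightarrow> prob {s \<in> space M. V x s \<in> B} = measure \<mu> B"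
  unfolding law_V[of x, symmetric] by (subst measure_distr) (auto intro!: arg_cong[where f=prob])

lemma prob_omega: "e \<in> edges \<Longrightarrow> B \<in> sets borel \<Longrightarrow> prob {s \<in> space M. \<omega> e s \<in> B} = measure \<nu> B"
  by (subst law_omega[of e, symmetric], simp, subst measure_distr) (auto intro!: arg_cong[where f=prob])

text \<open>The light vertices are independent, so a union bound over the sets of at least a quarter of the points
  suffices: there are at most \<open>2 ^ card S\<close> such sets, and each of them consists of light vertices with
  probability at most \<open>(1 / 256) ^ (card S / 4) = (1 / 4) ^ card S\<close>. Markov's inequality would only give a constant,
  since the bound \<open>1 / 256\<close> does not improve with the scale.\<close>

lemma prob_many_light_le:
  assumes "finite S" "measure \<mu> {..<a} \<le> 1 / 256"
  shows "prob {s \<in> space M. real (card S) \<le> 4 * real (card {w \<in> S. V w s < a})} \<le> (1/2) ^ card S"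
proof -
  let ?J = "{J. J \<subseteq> S \<and> real (card S) \<le> 4 * real (card J)}"
  have fin: "finite ?J" using assms(1) by auto
  have "{s \<in> space M. real (card S) \<le> 4 * real (card {w \<in> S. V w s < a})}
      \<subseteq> (\<Union>J\<in>?J. {s \<in> space M. \<forall>w\<in>J. V w s < a})" (is "?L \<subseteq> (\<Union>J\<in>?J. ?A J)")
  proof
    fix s assume "s \<in> ?L"
    then show "s \<in> (\<Union>J\<in>?J. ?A J)" by (intro UN_I[of "{w \<in> S. V w s < a}"]) auto
  qed
  moreover have meas: "?A J \<in> events" if "J \<in> ?J" for J
    using that assms(1) finite_subset[of J S] by (intro sets.sets_Collect_finite_All) auto
  ultimately have "prob ?L \<le> prob (\<Union>J\<in>?J. ?A J)"
    using fin by (intro finite_measure_mono sets.finite_UN) auto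
  also have "\<dots> \<le> (\<Sum>J\<in>?J. prob (?A J))"
    using fin meas by (intro finite_measure_subadditive_finite) auto
  also have "\<dots> \<le> (\<Sum>J\<in>?J. (1/4) ^ card S)"
  proof (intro sum_mono)
    fix J assume J: "J \<in> ?J"
    then have finJ: "finite J" using assms(1) finite_subset by blast
    have light: "{s \<in> space M. V w s < a} \<in> sets (info {Inl w})" for w
    proof -
      have [measurable]: "V w \<in> borel_measurable (info {Inl w})" by (intro V_measurable_info) simp
      show ?thesis unfolding space_info[of "{Inl w}", symmetric] by measurable
    qed
    have "?A J = space M \<inter> (\<Inter>w\<in>J. {s \<in> space M. V w s < a})" by auto
    also have "prob \<dots> = (\<Prod>w\<in>J. prob {s \<in> space M. V w s < a})"
      using finJ light by (intro prob_blocks[where I = "\<lambda>w. {Inl w}"]) (auto simp: disjoint_family_on_def)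
    also have "\<dots> \<le> (\<Prod>w\<in>J. 1/256)"
      using prob_V[of "{..<a}"] assms(2) by (intro prod_mono) auto
    also have "\<dots> = (1/4 :: real) ^ (4 * card J)" by (simp add: power_mult power_divide)
    also have "\<dots> \<le> (1/4) ^ card S" using J by (intro power_decreasing) auto
    finally show "prob (?A J) \<le> (1/4) ^ card S" .
  qed
  also have "\<dots> \<le> 2 ^ card S * (1/4) ^ card S"
    using card_mono[of "Pow S" ?J] assms(1) by (auto simp: card_Pow intro!: mult_right_mono)
  also have "\<dots> = (1/2) ^ card S" by (simp add: power_mult_distrib[symmetric])
  finally show ?thesis .
qed

end

lemma (in ilrfpp) mu_near_0:
  assumes "measure \<mu> {0<..} = 1"
  shows "((\<lambda>v. measure \<mu> {..<v}) \<longlongrightarrow> 0) (at_right 0)"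
proof -
  interpret mu: prob_space \<mu> unfolding law_V[of 0, symmetric] by (rule prob_space_distr) simp
  have [simp]: "sets \<mu> = sets borel" "space \<mu> = UNIV" unfolding law_V[of 0, symmetric] by auto
  have "measure \<mu> (space \<mu> - {0<..}) = 0" using assms by (subst mu.prob_compl) auto
  then have 0: "measure \<mu> {..0} = 0" by (simp add: Compl_eq_Diff_UNIV[symmetric] not_less Compl_greaterThan)
  have "(\<lambda>n. measure \<mu> {..<1 / real (Suc n)}) \<longlonglongrightarrow> measure \<mu> (\<Inter>n. {..<1 / real (Suc n)})"
    by (intro mu.finite_Lim_measure_decseq) (auto simp: decseq_def field_simps intro: less_le_trans[OF _ divide_left_mono])
  moreover have "(\<Inter>n. {..<1 / real (Suc n)}) = {..0::real}"
  proof (intro set_eqI iffI)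
    fix x :: real assume x: "x \<in> (\<Inter>n. {..<1 / real (Suc n)})"
    show "x \<in> {..0}"
    proof (rule ccontr)
      assume "x \<notin> {..0}"
      then obtain n where "inverse (real (Suc n)) < x" using reals_Archimedean[of x] by auto
      with x show False by (auto simp: inverse_eq_divide dest: spec[of _ n])
    qed
  qed (auto intro: le_less_trans)
  ultimately have lim: "(\<lambda>n. measure \<mu> {..<1 / real (Suc n)}) \<longlonglongrightarrow> 0" using 0 by simp
  show ?thesis
  proof (rule tendstoI)
    fix e :: real assume "0 < e"
    with lim obtain n where n: "measure \<mu> {..<1 / real (Suc n)} < e"
      using order_tendstoD(2)[OF lim] by (meson eventually_sequentially order_refl)
    have "\<forall>\<^sub>F v in at_right 0. v < 1 / real (Suc n)"
      by (intro order_tendstoD(2)[OF tendsto_ident_at]) auto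
    then show "\<forall>\<^sub>F v in at_right 0. dist (measure \<mu> {..<v}) 0 < e"
    proof eventually_elim
      case (elim v)
      have "measure \<mu> {..<v} \<le> measure \<mu> {..<1 / real (Suc n)}"
        using elim by (intro mu.finite_measure_mono) auto
      with n show ?case by simp
    qed
  qed
qed

lemma (in ilrfpp) nu_tail: "\<exists>t\<ge>1. measure \<nu> {t<..} \<le> 1 / 8"
proof -
  have "{0, 1 :: 'd site} \<in> edges"
    unfolding edges_def by (rule CollectI, intro exI[of _ 0] exI[of _ "1 :: 'd site"]) (simp add: vec_eq_iff)
  note e = this
  interpret nu: prob_space \<nu> unfolding law_omega[OF e, symmetric] by (rule prob_space_distr) (simp add: e)
  have [simp]: "sets \<nu> = sets borel" "space \<nu> = UNIV" unfolding law_omega[OF e, symmetric] by auto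
  have "(\<lambda>n. measure \<nu> {real n<..}) \<longlonglongrightarrow> measure \<nu> (\<Inter>n. {real n<..})"
    by (intro nu.finite_Lim_measure_decseq) (auto simp: decseq_def)
  also have "(\<Inter>n. {real n<..}) = {}"
    using reals_Archimedean2 less_asym by fastforce
  finally have "(\<lambda>n. measure \<nu> {real n<..}) \<longlonglongrightarrow> 0" by simp
  from order_tendstoD(2)[OF this, of "1/8"] eventually_ge_at_top[of 1]
  have "\<forall>\<^sub>F n in sequentially. measure \<nu> {real n<..} < 1/8 \<and> 1 \<le> n" by (intro eventually_conj) auto
  then obtain n where "measure \<nu> {real n<..} < 1/8" "1 \<le> n"
    using eventually_happens sequentially_bot by blast
  then show ?thesis by (intro exI[of _ "real n"]) auto
qed

text \<open>Where \<open>measure \<nu> {..x}\<close> vanishes, its logarithm and hence the quotient in the limit condition are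
  \<open>0\<close> as well, by \<open>ln 0 = 0\<close>; the eventual positivity of the quotient therefore excludes this case.\<close>

lemma (in ilrfpp_standing) omega_power_lower:
  assumes "\<theta> < \<theta>'"
  shows "\<forall>\<^sub>F x in at_right 0. x powr \<theta>' \<le> measure \<nu> {..x}"
proof -
  have "\<forall>\<^sub>F x in at_right (0::real). x < 1"
    by (intro order_tendstoD(2)[OF tendsto_ident_at]) auto
  moreover have "\<forall>\<^sub>F x in at_right (0::real). 0 < x" by (rule eventually_at_right_less)
  moreover have "\<forall>\<^sub>F x in at_right 0. ln (measure \<nu> {..x}) / ln x < \<theta>'"
    using order_tendstoD(2)[OF omega_near_0 assms] .
  moreover have "\<forall>\<^sub>F x in at_right 0. 0 < ln (measure \<nu> {..x}) / ln x"
    using order_tendstoD(1)[OF omega_near_0 theta_pos] .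
  ultimately show ?thesis
  proof eventually_elim
    case (elim x)
    have "measure \<nu> {..x} \<noteq> 0" using elim(4) by auto
    then have pos: "0 < measure \<nu> {..x}" by (simp add: zero_less_measure_iff)
    have "ln x < 0" using elim by simp
    then have "\<theta>' * ln x < ln (measure \<nu> {..x})" using elim(3) by (simp add: field_simps)
    then have "exp (\<theta>' * ln x) < measure \<nu> {..x}" using pos by (metis exp_less_cancel_iff exp_ln)
    then show ?case using elim by (simp add: powr_def)
  qed
qed

section \<open>A hierarchy of scales\<close>

text \<open>The base scale \<open>R\<close> is a parameter, so that it can grow with the distance to be bridged. The exponent \<open>\<theta>\<close> of
  this locale is slightly larger than the one of the standing assumptions, which turns the limit condition
  into the clean lower bound \<open>many_fast\<close>. The condition \<open>b_upper\<close> says that two cubes of side \<open>r\<close> at distance \<open>r powr b\<close>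
  are joined by many fast edges, and \<open>R_large\<close> that consecutive scales are well separated.\<close>

locale hierarchy = ilrfpp M V \<omega> \<mu> \<nu> \<alpha>
  for M :: "'s measure"
    and V :: "'d::finite site \<Rightarrow> 's \<Rightarrow> real"
    and \<omega> :: "'d site set \<Rightarrow> 's \<Rightarrow> real"
    and \<mu> \<nu> :: "real measure"
    and \<alpha> :: real +
  fixes v\<^sub>0 t \<theta> b R :: real
  assumes v\<^sub>0_pos: "0 < v\<^sub>0" and t_ge_1: "1 \<le> t" and b_gt_1: "1 < b"
    and R_ge_1: "1 \<le> R" and R_large: "6 \<le> R powr (b - 1)"
    and few_light: "measure \<mu> {..<v\<^sub>0} \<le> 1 / 256"
    and few_slow: "measure \<nu> {t<..} \<le> 1 / 8"
    and many_fast: "\<And>z. 6 * real CARD('d) * R \<le> z \<Longrightarrow> (z powr - \<alpha>) powr \<theta> \<le> measure \<nu> {..z powr - \<alpha>}"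
    and b_upper: "\<alpha> * \<theta> * b < 2 * real CARD('d)"
begin

definition scale :: "nat \<Rightarrow> real" where
  "scale k = R powr (b ^ k)"

definition rad :: "nat \<Rightarrow> int" where
  "rad k = \<lceil>scale k\<rceil>"

text \<open>The candidates for the far end of a gap of size \<open>rad k\<close> starting at \<open>u\<close>. They fill a shifted cube, away from \<open>u\<close>, so
  that the gap really has size \<open>rad k\<close> and the construction at the next lower scale works in two disjoint
  cubes \<open>region (k - 1)\<close> around its ends.\<close>

definition targets :: "nat \<Rightarrow> 'd site \<Rightarrow> 'd site set" where
  "targets k u = {w. \<forall>i. w $ i \<in> {u $ i + rad k <.. u $ i + 2 * rad k}}"

text \<open>The whole construction of a link at level \<open>k\<close> that starts at \<open>u\<close> takes place in this cube: the targets have offset at most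
  \<open>2 * rad k\<close>, and the cubes of the next lower level around them need at most \<open>3 * rad (k - 1) \<le> rad k\<close> more.\<close>

definition region :: "nat \<Rightarrow> 'd site \<Rightarrow> 'd site set" where
  "region k u = {w. \<forall>i. w $ i \<in> {u $ i .. u $ i + 3 * rad k}}"

text \<open>This bounds the length of the edge that is used between a target of \<open>u\<close> and a target of \<open>v\<close>, and determines
  the noise threshold \<open>reach k powr - \<alpha>\<close> below which such an edge has bounded passage time. The factor \<open>6\<close> arises
  since the coordinates of the ends differ by at most \<open>3 * rad (Suc k) \<le> 6 * scale (Suc k)\<close>.\<close>

definition reach :: "nat \<Rightarrow> real" where
  "reach k = 6 * real CARD('d) * scale k powr b"

definition num_targets :: "nat \<Rightarrow> nat" where
  "num_targets k = nat (rad k) ^ CARD('d)"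

definition relay :: "'d site \<Rightarrow> int \<Rightarrow> 'd site" where
  "relay u j = (\<chi> i. u $ i + j)"

text \<open>The weights of \<open>u\<close> and \<open>v\<close> themselves do not enter, so that linkage of a pair and heaviness of its
  ends can be estimated separately. Both gaps are traversed outwards, from \<open>u\<close> to \<open>u'\<close> and from \<open>v\<close> to \<open>v'\<close>,
  which makes the two ends symmetric; one of the two paths is reversed later.\<close>

primrec linked :: "nat \<Rightarrow> 's \<Rightarrow> 'd site \<Rightarrow> 'd site \<Rightarrow> bool" where
  "linked 0 s u v = (\<exists>j\<in>{1..rad 0}. v\<^sub>0 \<le> V (relay u j) s
      \<and> \<omega> {u, relay u j} s \<le> t \<and> \<omega> {relay u j, v} s \<le> t)"
| "linked (Suc k) s u v = (\<exists>u'\<in>targets k u. \<exists>v'\<in>targets k v. v\<^sub>0 \<le> V u' s \<and> v\<^sub>0 \<le> V v' s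
      \<and> \<omega> {u', v'} s \<le> reach k powr - \<alpha> \<and> linked k s u u' \<and> linked k s v v')"

lemma scale_0: "scale 0 = R"
  unfolding scale_def using R_ge_1 by simp

lemma scale_ge_R: "R \<le> scale k"
proof -
  have "R powr 1 \<le> R powr (b ^ k)"
    using R_ge_1 b_gt_1 by (intro powr_mono) auto
  then show ?thesis unfolding scale_def using R_ge_1 by simp
qed

lemma scale_ge_1: "1 \<le> scale k"
  using scale_ge_R[of k] R_ge_1 by simp

lemma scale_powr_b: "scale k powr b = scale (Suc k)"
  unfolding scale_def by (simp add: powr_powr mult.commute)

lemma scale_Suc_ge: "6 * scale k \<le> scale (Suc k)"
proof -
  have "6 * scale k \<le> scale k powr (b - 1) * scale k"
    using R_large powr_mono2[of "b - 1" R "scale k"] scale_ge_R[of k] R_ge_1 b_gt_1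
    by (intro mult_right_mono) auto
  also have "\<dots> = scale k powr b"
    using scale_ge_1[of k] powr_add[of "scale k" "b - 1" 1] by simp
  finally show ?thesis by (simp add: scale_powr_b)
qed

lemma rad_ge_scale: "scale k \<le> real_of_int (rad k)"
  unfolding rad_def by simp

lemma rad_le_scale: "real_of_int (rad k) \<le> 2 * scale k"
  unfolding rad_def using scale_ge_1[of k] of_int_ceiling_le_add_one[of "scale k"] by linarith

lemma rad_pos: "0 < rad k"
  using rad_ge_scale[of k] scale_ge_1[of k] by linarith

lemma rad_Suc: "3 * rad k \<le> rad (Suc k)"
  using rad_ge_scale[of "Suc k"] rad_le_scale[of k] scale_Suc_ge[of k] by linarith

text \<open>The disjointness of the two smaller cubes does double duty: it makes the concatenated path self-avoiding,
  and it separates the edges inside the cubes from those between them.\<close>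

lemma region_split:
  assumes "v \<in> targets (Suc k) u"
  shows "region k u \<subseteq> region (Suc k) u" "region k v \<subseteq> region (Suc k) u"
    and "region k u \<inter> region k v = {}"
proof -
  note r = rad_Suc[of k] rad_pos[of k]
  show "region k u \<subseteq> region (Suc k) u"
    unfolding region_def using r by fastforce
  show "region k v \<subseteq> region (Suc k) u"
  proof
    fix w assume w: "w \<in> region k v"
    show "w \<in> region (Suc k) u" unfolding region_def
    proof (intro CollectI allI)
      fix i
      have "w $ i \<in> {v $ i .. v $ i + 3 * rad k}" "v $ i \<in> {u $ i + rad (Suc k) <.. u $ i + 2 * rad (Suc k)}"
        using w assms unfolding region_def targets_def by blast+
      then show "w $ i \<in> {u $ i .. u $ i + 3 * rad (Suc k)}" using r by auto
    qed
  qed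
  show "region k u \<inter> region k v = {}"
  proof (rule ccontr)
    assume "region k u \<inter> region k v \<noteq> {}"
    then obtain w where w: "w \<in> region k u" "w \<in> region k v" by blast
    fix i :: 'd
    have "w $ i \<in> {u $ i .. u $ i + 3 * rad k}" "w $ i \<in> {v $ i .. v $ i + 3 * rad k}" "v $ i \<in> {u $ i + rad (Suc k) <.. u $ i + 2 * rad (Suc k)}"
      using w assms unfolding region_def targets_def by blast+
    then show False using r by auto
  qed
qed

lemma targets_subset_region: "targets k u \<subseteq> region k u"
proof -
  have "{a + rad k <.. a + 2 * rad k} \<subseteq> {a .. a + 3 * rad k}" for a
    using rad_pos[of k] by auto
  then show ?thesis unfolding targets_def region_def by blast
qed

lemma self_in_region: "u \<in> region k u"
  unfolding region_def using rad_pos[of k] by auto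

lemma relay_in_region: "j \<in> {1..rad 0} \<Longrightarrow> relay u j \<in> region 0 u"
  unfolding region_def relay_def by auto

lemma relay_neq:
  assumes "j \<in> {1..rad 0}"
  shows "relay u j \<noteq> u" and "v \<in> targets 0 u \<Longrightarrow> relay u j \<noteq> v"
proof -
  fix i :: 'd
  show "relay u j \<noteq> u" using assms by (auto simp: relay_def vec_eq_iff intro!: exI[of _ i])
  assume "v \<in> targets 0 u"
  then have "v $ i \<in> {u $ i + rad 0 <.. u $ i + 2 * rad 0}" unfolding targets_def by blast
  then have "relay u j $ i \<noteq> v $ i" using assms by (auto simp: relay_def)
  then show "relay u j \<noteq> v" by auto
qed

lemma finite_targets: "finite (targets k u)"
  unfolding targets_def by (intro card_box) auto

lemma card_targets: "card (targets k u) = num_targets k"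
  unfolding targets_def num_targets_def by (subst card_box) auto

lemma num_targets_ge: "scale k ^ CARD('d) \<le> real (num_targets k)"
  unfolding num_targets_def using rad_ge_scale[of k] rad_pos[of k] scale_ge_1[of k]
  by (auto intro!: power_mono)

lemma l1_norm_targets_le:
  assumes "v \<in> targets (Suc k) u" "u' \<in> targets k u" "v' \<in> targets k v"
  shows "l1_norm (u' - v') \<le> reach k"
proof -
  have "\<bar>real_of_int ((u' - v') $ i)\<bar> \<le> real_of_int (3 * rad (Suc k))" for i
  proof -
    have "v $ i \<in> {u $ i + rad (Suc k) <.. u $ i + 2 * rad (Suc k)}"
      "u' $ i \<in> {u $ i + rad k <.. u $ i + 2 * rad k}"
      "v' $ i \<in> {v $ i + rad k <.. v $ i + 2 * rad k}"
      using assms unfolding targets_def by blast+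
    then have "\<bar>(u' - v') $ i\<bar> \<le> 3 * rad (Suc k)" using rad_Suc[of k] by auto
    then show ?thesis by linarith
  qed
  then have "l1_norm (u' - v') \<le> real CARD('d) * real_of_int (3 * rad (Suc k))"
    by (rule l1_norm_le)
  also have "\<dots> \<le> real CARD('d) * (6 * scale (Suc k))"
    using rad_le_scale[of "Suc k"] by (intro mult_left_mono) auto
  finally show ?thesis unfolding reach_def scale_powr_b by simp
qed

section \<open>Links give short paths\<close>

lemma paths_join:
  assumes p: "p \<in> paths u u'" "set p \<subseteq> P" "path_time \<alpha> V \<omega> s p \<le> a"
    and q: "q \<in> paths v v'" "set q \<subseteq> Q" "path_time \<alpha> V \<omega> s q \<le> c"
    and "P \<inter> Q = {}" "edge_time \<alpha> V \<omega> s u' v' \<le> e"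
  shows "\<exists>p\<in>paths u v. set p \<subseteq> P \<union> Q \<and> path_time \<alpha> V \<omega> s p \<le> a + e + c"
proof (intro bexI conjI)
  show "p @ rev q \<in> paths u v"
    using assms unfolding paths_def by (auto simp: last_rev hd_rev)
  show "set (p @ rev q) \<subseteq> P \<union> Q" using p q by auto
  show "path_time \<alpha> V \<omega> s (p @ rev q) \<le> a + e + c"
    using assms unfolding paths_def by (auto simp: path_time_append hd_rev path_time_rev)
qed

text \<open>With \<open>m\<close> a lower bound for the weights, this bounds the passage time of every edge that is
  used: a short edge at scale \<open>0\<close> has length at most twice \<open>CARD('d) * rad 0\<close> and noise at most \<open>t\<close>, and
  a fast long edge takes only \<open>1 / m\<^sup>2\<close>.\<close>

definition edge_cost :: "real \<Rightarrow> real" where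
  "edge_cost m = (2 * real CARD('d) * real_of_int (rad 0)) powr \<alpha> * t / m\<^sup>2"

lemma edge_cost_nonneg: "0 \<le> edge_cost m"
  unfolding edge_cost_def using t_ge_1 by simp

lemma long_edge_time_le:
  assumes "0 < m" "m \<le> v\<^sub>0" "v\<^sub>0 \<le> V u s" "v\<^sub>0 \<le> V v s" "\<omega> {u, v} s \<le> reach k powr - \<alpha>"
    "l1_norm (u - v) \<le> reach k"
  shows "edge_time \<alpha> V \<omega> s u v \<le> edge_cost m"
proof -
  have r: "0 < reach k" unfolding reach_def using scale_ge_1[of k] by simp
  have "edge_time \<alpha> V \<omega> s u v \<le> reach k powr \<alpha> * reach k powr - \<alpha> / m\<^sup>2"
    using assms alpha_pos by (intro edge_time_le) auto
  also have "\<dots> = 1 / m\<^sup>2"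
    using r by (simp add: powr_minus field_simps)
  also have "\<dots> \<le> edge_cost m"
  proof -
    have "1 * 1 * 1 \<le> 2 * real CARD('d) * real_of_int (rad 0)"
      using rad_pos[of 0] by (intro mult_mono) auto
    then have "1 powr \<alpha> * 1 \<le> (2 * real CARD('d) * real_of_int (rad 0)) powr \<alpha> * t"
      using t_ge_1 alpha_pos by (intro mult_mono powr_mono2) auto
    then show ?thesis unfolding edge_cost_def by (intro divide_right_mono) auto
  qed
  finally show ?thesis .
qed

lemma linked_0_path:
  assumes "linked 0 s u v" "v \<in> targets 0 u" "0 < m" "m \<le> v\<^sub>0" "m \<le> V u s" "m \<le> V v s"
  shows "\<exists>p\<in>paths u v. set p \<subseteq> region 0 u \<and> path_time \<alpha> V \<omega> s p \<le> 2 * edge_cost m"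
proof -
  obtain j where j: "j \<in> {1..rad 0}" and w: "v\<^sub>0 \<le> V (relay u j) s"
      "\<omega> {u, relay u j} s \<le> t" "\<omega> {relay u j, v} s \<le> t"
    using assms(1) by auto
  have uv: "v $ i \<in> {u $ i + rad 0 <.. u $ i + 2 * rad 0}" for i
    using assms(2) unfolding targets_def by blast
  have "u \<noteq> v" using uv rad_pos[of 0] by force
  have l: "l1_norm (u - relay u j) \<le> real CARD('d) * (2 * real_of_int (rad 0))"
    using j by (intro l1_norm_le) (auto simp: relay_def)
  have l': "l1_norm (relay u j - v) \<le> real CARD('d) * (2 * real_of_int (rad 0))"
  proof (intro l1_norm_le)
    fix i
    have "\<bar>(relay u j - v) $ i\<bar> \<le> 2 * rad 0" using uv[of i] j by (auto simp: relay_def)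
    then show "\<bar>real_of_int ((relay u j - v) $ i)\<bar> \<le> 2 * real_of_int (rad 0)" by linarith
  qed
  have e: "edge_time \<alpha> V \<omega> s u (relay u j) \<le> edge_cost m"
    unfolding edge_cost_def using assms w l t_ge_1 alpha_pos by (intro edge_time_le) (auto simp: mult_ac)
  have e': "edge_time \<alpha> V \<omega> s (relay u j) v \<le> edge_cost m"
    unfolding edge_cost_def using assms w l' t_ge_1 alpha_pos by (intro edge_time_le) (auto simp: mult_ac)
  have "[u, relay u j, v] \<in> paths u v"
    using relay_neq[OF j, of u] relay_neq(2)[OF j assms(2)] \<open>u \<noteq> v\<close> by (auto simp: paths_def)
  moreover have "set [u, relay u j, v] \<subseteq> region 0 u"
    using self_in_region[of u 0] relay_in_region[OF j, of u] targets_subset_region[of 0 u] assms(2) by auto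
  moreover have "path_time \<alpha> V \<omega> s [u, relay u j, v] \<le> 2 * edge_cost m"
    using e e' by (simp add: path_time_Cons_Cons path_time_singleton)
  ultimately show ?thesis by blast
qed

text \<open>The number of edges satisfies \<open>e 0 = 2\<close> and \<open>e (k + 1) = 2 * e k + 1\<close>, hence \<open>e k = 3 * 2 ^ k - 1\<close>. The step is
  formulated for arbitrary \<open>u\<close> and \<open>v\<close> with disjoint cubes, because on the top level the end vertex need not
  lie in a cube of targets.\<close>

lemma linked_Suc_path:
  assumes IH: "\<And>u v. linked k s u v \<Longrightarrow> v \<in> targets k u \<Longrightarrow> m \<le> V u s \<Longrightarrow> m \<le> V v s \<Longrightarrow>
      \<exists>p\<in>paths u v. set p \<subseteq> region k u \<and> path_time \<alpha> V \<omega> s p \<le> (3 * 2 ^ k - 1) * edge_cost m"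
    and "linked (Suc k) s u v" "0 < m" "m \<le> v\<^sub>0" "m \<le> V u s" "m \<le> V v s"
    and disj: "region k u \<inter> region k v = {}"
    and near: "\<And>u' v'. u' \<in> targets k u \<Longrightarrow> v' \<in> targets k v \<Longrightarrow> l1_norm (u' - v') \<le> reach k"
  shows "\<exists>p\<in>paths u v. set p \<subseteq> region k u \<union> region k v \<and>
      path_time \<alpha> V \<omega> s p \<le> (3 * 2 ^ Suc k - 1) * edge_cost m"
proof -
  obtain u' v' where u': "u' \<in> targets k u" "v\<^sub>0 \<le> V u' s" "linked k s u u'"
    and v': "v' \<in> targets k v" "v\<^sub>0 \<le> V v' s" "linked k s v v'"
    and w: "\<omega> {u', v'} s \<le> reach k powr - \<alpha>"
    using assms(2) by auto
  have e: "edge_time \<alpha> V \<omega> s u' v' \<le> edge_cost m"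
    using assms u' v' w near by (intro long_edge_time_le) auto
  obtain p where p: "p\<in>paths u u'" "set p \<subseteq> region k u" "path_time \<alpha> V \<omega> s p \<le> (3 * 2 ^ k - 1) * edge_cost m"
    using IH[of u u'] u'(1,3) assms(4,5) order_trans[OF assms(4) u'(2)] by blast
  obtain q where q: "q\<in>paths v v'" "set q \<subseteq> region k v" "path_time \<alpha> V \<omega> s q \<le> (3 * 2 ^ k - 1) * edge_cost m"
    using IH[of v v'] v'(1,3) assms(4,6) order_trans[OF assms(4) v'(2)] by blast
  from paths_join[OF p q disj e] show ?thesis by (simp add: algebra_simps)
qed

lemma linked_path:
  assumes "linked k s u v" "v \<in> targets k u" "0 < m" "m \<le> v\<^sub>0" "m \<le> V u s" "m \<le> V v s"
  shows "\<exists>p\<in>paths u v. set p \<subseteq> region k u \<and> path_time \<alpha> V \<omega> s p \<le> (3 * 2 ^ k - 1) * edge_cost m"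
  using assms
proof (induction k arbitrary: u v)
  case 0
  then show ?case using linked_0_path by simp
next
  case (Suc k)
  have "\<exists>p\<in>paths u v. set p \<subseteq> region k u \<union> region k v \<and>
      path_time \<alpha> V \<omega> s p \<le> (3 * 2 ^ Suc k - 1) * edge_cost m"
    using Suc.prems by (intro linked_Suc_path Suc.IH region_split l1_norm_targets_le) auto
  then show ?case using region_split[OF Suc.prems(2)] by (meson Un_subset_iff subset_trans sup.mono sup.idem le_sup_iff)
qed

lemma passage_time_le:
  assumes "linked (Suc k) s u v" "0 < m" "m \<le> v\<^sub>0" "m \<le> V u s" "m \<le> V v s"
    and disj: "region k u \<inter> region k v = {}"
    and near: "\<And>u' v'. u' \<in> targets k u \<Longrightarrow> v' \<in> targets k v \<Longrightarrow> l1_norm (u' - v') \<le> reach k"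
  shows "passage_time \<alpha> V \<omega> s u v \<le> ereal (3 * 2 ^ Suc k * edge_cost m)"
proof -
  obtain p where p: "p \<in> paths u v" "path_time \<alpha> V \<omega> s p \<le> (3 * 2 ^ Suc k - 1) * edge_cost m"
    using linked_Suc_path[OF linked_path assms(1-7)] assms near by blast
  from edge_cost_nonneg[of m] have "path_time \<alpha> V \<omega> s p \<le> 3 * 2 ^ Suc k * edge_cost m"
    using p(2) by (simp add: algebra_simps)
  then show ?thesis unfolding passage_time_def by (intro INF_lower2[OF p(1)]) simp
qed

section \<open>Most pairs at a fixed scale are linked\<close>

text \<open>All vertex weights are included, but only the edges within \<open>D\<close>: edges between two disjoint cubes
  are then never among the data of either cube.\<close>

definition inside :: "'d site set \<Rightarrow> ('d site + 'd site set) set" where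
  "inside D = UNIV <+> {e \<in> edges. e \<subseteq> D}"

lemma inside_mono: "D \<subseteq> D' \<Longrightarrow> inside D \<subseteq> inside D'"
  unfolding inside_def by auto

lemma inside_edge: "x \<noteq> y \<Longrightarrow> x \<in> D \<Longrightarrow> y \<in> D \<Longrightarrow> Inr {x, y} \<in> inside D"
  unfolding inside_def edges_def by auto

lemma linked_in_info:
  assumes "v \<in> targets k u" "inside (region k u) \<subseteq> J"
  shows "{s \<in> space M. linked k s u v} \<in> sets (info J)"
  using assms
proof (induction k arbitrary: u v)
  case 0
  have "{s \<in> space (info J). v\<^sub>0 \<le> V (relay u j) s \<and> \<omega> {u, relay u j} s \<le> t \<and> \<omega> {relay u j, v} s \<le> t}
       \<in> sets (info J)" if j: "j \<in> {1..rad 0}" for j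
  proof -
    note [measurable] = V_measurable_info[of "relay u j" J] omega_measurable_info[of "{u, relay u j}" J] omega_measurable_info[of "{relay u j, v}" J]
    have "Inr {u, relay u j} \<in> inside (region 0 u)" "Inr {relay u j, v} \<in> inside (region 0 u)"
      using 0(1) relay_neq(1)[OF j, of u] relay_neq(2)[OF j 0(1)] relay_in_region[OF j, of u]
        self_in_region[of u 0] targets_subset_region[of 0 u]
      by (auto intro!: inside_edge)
    then have [simp]: "Inr {u, relay u j} \<in> J" "Inr {relay u j, v} \<in> J" "Inl (relay u j) \<in> J"
      using 0(2) by (auto simp: inside_def)
    show ?thesis by measurable
  qed
  then have "{s \<in> space (info J). linked 0 s u v} \<in> sets (info J)"
    unfolding linked.simps by (intro sets.sets_Collect_finite_Ex) auto
  then show ?case by simp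
next
  case (Suc k)
  have sub: "inside (region k u) \<subseteq> J" "inside (region k v) \<subseteq> J"
    using region_split[OF Suc.prems(1)] inside_mono Suc.prems(2) by blast+
  have "{s \<in> space (info J). v\<^sub>0 \<le> V u' s \<and> v\<^sub>0 \<le> V v' s
      \<and> \<omega> {u', v'} s \<le> reach k powr - \<alpha> \<and> linked k s u u' \<and> linked k s v v'} \<in> sets (info J)"
    if "u' \<in> targets k u" "v' \<in> targets k v" for u' v'
  proof -
    have reg: "u' \<in> region k u" "v' \<in> region k v"
      using that targets_subset_region by auto
    then have "Inr {u', v'} \<in> J"
      using region_split[OF Suc.prems(1)] inside_edge[of u' v' "region (Suc k) u"] Suc.prems(2) by auto
    moreover have "Inl u' \<in> J" "Inl v' \<in> J" using Suc.prems(2) by (auto simp: inside_def)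
    ultimately have [measurable]: "V u' \<in> borel_measurable (info J)" "V v' \<in> borel_measurable (info J)" "\<omega> {u', v'} \<in> borel_measurable (info J)"
      using V_measurable_info omega_measurable_info by auto
    have [measurable]: "Measurable.pred (info J) (\<lambda>s. linked k s u u')" "Measurable.pred (info J) (\<lambda>s. linked k s v v')"
      using Suc.IH[OF that(1) sub(1)] Suc.IH[OF that(2) sub(2)] by (simp_all add: pred_def)
    show ?thesis by measurable
  qed
  then have "{s \<in> space (info J). linked (Suc k) s u v} \<in> sets (info J)"
    unfolding linked.simps by (intro sets.sets_Collect_finite_Ex finite_targets)
  then show ?case by simp
qed

text \<open>Each intermediate vertex fails with probability at most \<open>1 / 256 + 1 / 8 + 1 / 8\<close>, and distinct
  intermediate vertices involve disjoint sets of weights and noises.\<close>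

lemma prob_not_linked_0:
  assumes "v \<in> targets 0 u"
  shows "prob {s \<in> space M. \<not> linked 0 s u v} \<le> (1/2) ^ nat (rad 0)"
proof -
  let ?I = "\<lambda>j. {Inl (relay u j), Inr {u, relay u j}, Inr {relay u j, v}}"
  let ?A = "\<lambda>j. {s \<in> space M. \<not> (v\<^sub>0 \<le> V (relay u j) s \<and> \<omega> {u, relay u j} s \<le> t \<and> \<omega> {relay u j, v} s \<le> t)}"
  note neq = relay_neq(1)[of _ u] relay_neq(2)[OF _ assms]
  have edges: "{u, relay u j} \<in> edges" "{relay u j, v} \<in> edges" if "j \<in> {1..rad 0}" for j
    using neq[OF that] unfolding edges_def by blast+
  have inj: "relay u i = relay u j \<Longrightarrow> i = j" for i j
    by (auto simp: relay_def vec_eq_iff)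
  have "{s \<in> space M. \<not> linked 0 s u v} = space M \<inter> (\<Inter>j\<in>{1..rad 0}. ?A j)"
    by auto
  also have "prob \<dots> = (\<Prod>j\<in>{1..rad 0}. prob (?A j))"
  proof (rule prob_blocks[where I = ?I])
    show "disjoint_family_on ?I {1..rad 0}"
      using neq inj unfolding disjoint_family_on_def by (auto simp: doubleton_eq_iff)
    show "(\<Union>j\<in>{1..rad 0}. ?I j) \<subseteq> UNIV <+> edges" using edges by auto
    fix j assume "j \<in> {1..rad 0}"
    have [measurable]: "V (relay u j) \<in> borel_measurable (info (?I j))"
      "\<omega> {u, relay u j} \<in> borel_measurable (info (?I j))" "\<omega> {relay u j, v} \<in> borel_measurable (info (?I j))"
      by (auto intro!: V_measurable_info omega_measurable_info)
    show "?A j \<in> sets (info (?I j))" unfolding space_info[of "?I j", symmetric] by measurable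
  qed auto
  also have "\<dots> \<le> (\<Prod>j\<in>{1..rad 0}. 1/2)"
  proof (intro prod_mono conjI measure_nonneg)
    fix j assume j: "j \<in> {1..rad 0}"
    note [measurable] = edges[OF j]
    have "prob (?A j) \<le> prob ({s \<in> space M. V (relay u j) s \<in> {..<v\<^sub>0}} \<union> ({s \<in> space M. \<omega> {u, relay u j} s \<in> {t<..}}
         \<union> {s \<in> space M. \<omega> {relay u j, v} s \<in> {t<..}}))"
      by (intro finite_measure_mono) auto
    also have "\<dots> \<le> prob {s \<in> space M. V (relay u j) s \<in> {..<v\<^sub>0}} + (prob {s \<in> space M. \<omega> {u, relay u j} s \<in> {t<..}}
         + prob {s \<in> space M. \<omega> {relay u j, v} s \<in> {t<..}})"
      by (intro order_trans[OF measure_Un_le] add_left_mono) auto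
    also have "\<dots> \<le> 1/256 + (1/8 + 1/8)"
      using prob_V[of "{..<v\<^sub>0}"] prob_omega[OF edges(1)[OF j], of "{t<..}"] prob_omega[OF edges(2)[OF j], of "{t<..}"] few_light few_slow
      by simp
    finally show "prob (?A j) \<le> 1/2" by simp
  qed
  finally show ?thesis by simp
qed

text \<open>The points near \<open>w\<close> at which a fast edge may start or end.\<close>

definition hubs :: "nat \<Rightarrow> 'd site \<Rightarrow> 's \<Rightarrow> 'd site set" where
  "hubs k w s = {w' \<in> targets k w. linked k s w w' \<and> v\<^sub>0 \<le> V w' s}"

definition fast_prob :: "nat \<Rightarrow> real" where
  "fast_prob k = measure \<nu> {..reach k powr - \<alpha>}"

lemma hubs_event:
  assumes "P \<subseteq> targets k w" "inside (region k w) \<subseteq> J"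
  shows "{s \<in> space M. hubs k w s = P} \<in> sets (info J)"
proof -
  have "{s \<in> space (info J). (linked k s w w' \<and> v\<^sub>0 \<le> V w' s) = (w' \<in> P)} \<in> sets (info J)"
    if "w' \<in> targets k w" for w'
  proof -
    have [measurable]: "V w' \<in> borel_measurable (info J)"
      using assms(2) by (intro V_measurable_info) (auto simp: inside_def)
    have [measurable]: "Measurable.pred (info J) (\<lambda>s. linked k s w w')"
      using linked_in_info[OF that assms(2)] by (simp add: pred_def)
    show ?thesis by measurable
  qed
  then have "{s \<in> space (info J). \<forall>w'\<in>targets k w. (linked k s w w' \<and> v\<^sub>0 \<le> V w' s) = (w' \<in> P)} \<in> sets (info J)"
    by (intro sets.sets_Collect_finite_All finite_targets)
  also have "{s \<in> space (info J). \<forall>w'\<in>targets k w. (linked k s w w' \<and> v\<^sub>0 \<le> V w' s) = (w' \<in> P)}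
      = {s \<in> space M. hubs k w s = P}"
    using assms(1) unfolding hubs_def by auto
  finally show ?thesis .
qed

lemma inside_subset: "inside D \<subseteq> UNIV <+> edges"
  unfolding inside_def by auto

text \<open>Once the two sets of hubs are prescribed, the edges between them are independent of this event, because the
  hubs are determined by data inside two disjoint cubes. The blocks are indexed by an option type: \<open>None\<close> stands for
  all the inside data, \<open>Some (u', v')\<close> for a single edge.\<close>

lemma prob_hubs_unbridged:
  assumes disj: "region k u \<inter> region k v = {}"
    and P: "P \<subseteq> targets k u" and Q: "Q \<subseteq> targets k v"
  shows "{s \<in> space M. hubs k u s = P \<and> hubs k v s = Q} \<in> events" (is "?C \<in> _")
    and "{s \<in> space M. hubs k u s = P \<and> hubs k v s = Q \<and> (\<forall>u'\<in>P. \<forall>v'\<in>Q. reach k powr - \<alpha> < \<omega> {u', v'} s)} \<in> events"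
    and "prob {s \<in> space M. hubs k u s = P \<and> hubs k v s = Q \<and>
        (\<forall>u'\<in>P. \<forall>v'\<in>Q. reach k powr - \<alpha> < \<omega> {u', v'} s)}
      \<le> prob {s \<in> space M. hubs k u s = P \<and> hubs k v s = Q} * exp (- (fast_prob k * (real (card P) * real (card Q))))"
proof -
  let ?J = "inside (region k u) \<union> inside (region k v)"
  let ?I = "\<lambda>j. case j of None \<Rightarrow> ?J | Some (u', v') \<Rightarrow> {Inr {u', v'}}"
  let ?S = "\<lambda>u' v'. {s \<in> space M. reach k powr - \<alpha> < \<omega> {u', v'} s}"
  let ?A = "\<lambda>j. case j of None \<Rightarrow> ?C | Some (u', v') \<Rightarrow> ?S u' v'"
  let ?K = "insert None (Some ` (P \<times> Q))"
  have reg: "u' \<in> region k u" "u' \<notin> region k v" "v' \<in> region k v" "v' \<notin> region k u" "u' \<noteq> v'"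
     if "u' \<in> P" "v' \<in> Q" for u' v'
    using that P Q disj targets_subset_region by blast+
  have edge: "{u', v'} \<in> edges" if "u' \<in> P" "v' \<in> Q" for u' v'
    using reg(5)[OF that] unfolding edges_def by blast
  have fin: "finite P" "finite Q" using P Q finite_targets finite_subset by blast+
  have C: "?C \<in> sets (info ?J)"
  proof -
    have "?C = {s \<in> space M. hubs k u s = P} \<inter> {s \<in> space M. hubs k v s = Q}" by auto
    also have "\<dots> \<in> sets (info ?J)" using P Q by (intro sets.Int hubs_event) auto
    finally show ?thesis .
  qed
  have JM: "?J \<subseteq> UNIV <+> edges" using inside_subset by blast
  show CM: "?C \<in> events" using C sets_info_le[OF JM] by blast
  have S: "?S u' v' \<in> sets (info {Inr {u', v'}})" for u' v'
  proof -
    have [measurable]: "\<omega> {u', v'} \<in> borel_measurable (info {Inr {u', v'}})"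
      by (intro omega_measurable_info) simp
    show ?thesis unfolding space_info[of "{Inr {u', v'}}", symmetric] by measurable
  qed
  let ?F = "{s \<in> space M. hubs k u s = P \<and> hubs k v s = Q \<and> (\<forall>u'\<in>P. \<forall>v'\<in>Q. reach k powr - \<alpha> < \<omega> {u', v'} s)}"
  have eq: "?F = space M \<inter> (\<Inter>j\<in>?K. ?A j)"
    by (auto split: prod.splits)
  have AM: "?A j \<in> events" if "j \<in> ?K" for j
    using that CM edge by (auto split: prod.splits)
  have "?F = ?C \<inter> {s \<in> space M. \<forall>u'\<in>P. \<forall>v'\<in>Q. reach k powr - \<alpha> < \<omega> {u', v'} s}" by auto
  also have "\<dots> \<in> events"
    using CM fin edge by (intro sets.Int sets.sets_Collect_finite_All) auto
  finally show "?F \<in> events" .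
  have "prob ?F = (\<Prod>j\<in>?K. prob (?A j))"
    unfolding eq
  proof (rule prob_blocks[where I = ?I])
    have "?I i \<inter> ?I j = {}" if "i \<in> ?K" "j \<in> ?K" "i \<noteq> j" for i j
      using that reg by (auto simp: inside_def doubleton_eq_iff split: prod.splits)
    then show "disjoint_family_on ?I ?K" unfolding disjoint_family_on_def by blast
    show "(\<Union>j\<in>?K. ?I j) \<subseteq> UNIV <+> edges" using JM edge by (auto split: prod.splits)
    show "?A j \<in> sets (info (?I j))" if "j \<in> ?K" for j
    proof (cases j)
      case None
      show ?thesis unfolding None option.case by (rule C)
    next
      case (Some a)
      show ?thesis unfolding Some option.case split_beta by (rule S)
    qed
    show "finite ?K" using fin by blast
  qed
  also have "\<dots> = prob ?C * (\<Prod>j\<in>Some ` (P \<times> Q). prob (?A j))"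
    using fin by (subst prod.insert) auto
  also have "(\<Prod>j\<in>Some ` (P \<times> Q). prob (?A j)) = (\<Prod>(u', v')\<in>P \<times> Q. prob (?S u' v'))"
    by (subst prod.reindex) (auto intro!: prod.cong)
  also have "\<dots> = (\<Prod>(u', v')\<in>P \<times> Q. 1 - fast_prob k)"
  proof (intro prod.cong refl, clarify)
    fix u' v' assume uv: "u' \<in> P" "v' \<in> Q"
    have [measurable]: "\<omega> {u', v'} \<in> borel_measurable M" using edge[OF uv] by (rule omega_measurable)
    have "?S u' v' = space M - {s \<in> space M. \<omega> {u', v'} s \<in> {..reach k powr - \<alpha>}}" by auto
    also have "prob \<dots> = 1 - fast_prob k"
      unfolding fast_prob_def using prob_omega[OF edge[OF uv], of "{..reach k powr - \<alpha>}"]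
      by (subst prob_compl) auto
    finally show "prob (?S u' v') = 1 - fast_prob k" .
  qed
  also have "\<dots> = (1 - fast_prob k) ^ (card P * card Q)"
    by (simp add: split_beta card_cartesian_product)
  also have "prob ?C * \<dots> \<le> prob ?C * exp (- (fast_prob k * (real (card P) * real (card Q))))"
  proof (cases "P = {} \<or> Q = {}")
    case False
    then obtain u' v' where "u' \<in> P" "v' \<in> Q" by blast
    note e = edge[OF this]
    have "fast_prob k = prob {s \<in> space M. \<omega> {u', v'} s \<in> {..reach k powr - \<alpha>}}"
      unfolding fast_prob_def by (rule prob_omega[OF e, symmetric]) simp
    then have "fast_prob k \<le> 1" by simp
    then have "(1 - fast_prob k) ^ (card P * card Q) \<le> exp (- fast_prob k) ^ (card P * card Q)"
      using exp_ge_add_one_self[of "- fast_prob k"] by (intro power_mono) auto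
    also have "\<dots> = exp (- (fast_prob k * (real (card P) * real (card Q))))"
      by (simp add: exp_of_nat_mult[symmetric] mult_ac)
    finally show ?thesis by (intro mult_left_mono) auto
  qed auto
  finally show "prob ?F \<le> prob ?C * exp (- (fast_prob k * (real (card P) * real (card Q))))" .
qed

text \<open>Decompose according to the values of the two random sets of hubs. Each pair of values leaves at least
  \<open>(num_targets k)\<^sup>2 / 4\<close> independent edges, and the probabilities of the values add up to at most \<open>1\<close>.\<close>

lemma prob_no_bridge:
  assumes disj: "region k u \<inter> region k v = {}"
  shows "{s \<in> space M. num_targets k \<le> 2 * card (hubs k u s) \<and> num_targets k \<le> 2 * card (hubs k v s) \<and>
      (\<forall>u'\<in>hubs k u s. \<forall>v'\<in>hubs k v s. reach k powr - \<alpha> < \<omega> {u', v'} s)} \<in> events" (is "?L \<in> _")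
    and "prob {s \<in> space M. num_targets k \<le> 2 * card (hubs k u s) \<and> num_targets k \<le> 2 * card (hubs k v s) \<and>
      (\<forall>u'\<in>hubs k u s. \<forall>v'\<in>hubs k v s. reach k powr - \<alpha> < \<omega> {u', v'} s)}
      \<le> exp (- (fast_prob k * (real (num_targets k))\<^sup>2 / 4))"
proof -
  let ?T = "{P. P \<subseteq> targets k u \<and> num_targets k \<le> 2 * card P} \<times> {Q. Q \<subseteq> targets k v \<and> num_targets k \<le> 2 * card Q}"
  let ?F = "\<lambda>(P, Q). {s \<in> space M. hubs k u s = P \<and> hubs k v s = Q \<and> (\<forall>u'\<in>P. \<forall>v'\<in>Q. reach k powr - \<alpha> < \<omega> {u', v'} s)}"
  let ?C = "\<lambda>(P, Q). {s \<in> space M. hubs k u s = P \<and> hubs k v s = Q}"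
  have fin: "finite ?T" using finite_targets by auto
  have F: "?F T \<in> events" "?C T \<in> events" if "T \<in> ?T" for T
    using that prob_hubs_unbridged(1,2)[OF disj, of "fst T" "snd T"] by (auto simp: split_beta)
  have hubs: "hubs k w s \<subseteq> targets k w" for w s unfolding hubs_def by blast
  have eq: "?L = (\<Union>T\<in>?T. ?F T)" using hubs by auto
  show "?L \<in> events" unfolding eq using fin F by (intro sets.finite_UN) auto
  have "prob ?L \<le> (\<Sum>T\<in>?T. prob (?F T))"
    unfolding eq using fin F by (intro finite_measure_subadditive_finite) auto
  also have "\<dots> \<le> (\<Sum>T\<in>?T. prob (?C T) * exp (- (fast_prob k * (real (num_targets k))\<^sup>2 / 4)))"
  proof (intro sum_mono)
    fix T assume "T \<in> ?T"
    then obtain P Q where T: "T = (P, Q)"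
      and PQ: "P \<subseteq> targets k u" "Q \<subseteq> targets k v" "num_targets k \<le> 2 * card P" "num_targets k \<le> 2 * card Q"
      by blast
    have "real (num_targets k) / 2 * (real (num_targets k) / 2) \<le> real (card P) * real (card Q)"
      using PQ(3,4) by (intro mult_mono) auto
    then have "fast_prob k * (real (num_targets k) / 2 * (real (num_targets k) / 2)) \<le> fast_prob k * (real (card P) * real (card Q))"
      by (intro mult_left_mono) (auto simp: fast_prob_def)
    then have "exp (- (fast_prob k * (real (card P) * real (card Q)))) \<le> exp (- (fast_prob k * (real (num_targets k))\<^sup>2 / 4))"
      by (simp add: power2_eq_square)
    then have "prob (?C (P, Q)) * exp (- (fast_prob k * (real (card P) * real (card Q)))) \<le> prob (?C (P, Q)) * exp (- (fast_prob k * (real (num_targets k))\<^sup>2 / 4))"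
      by (intro mult_left_mono) auto
    with prob_hubs_unbridged(3)[OF disj PQ(1,2)]
    show "prob (?F T) \<le> prob (?C T) * exp (- (fast_prob k * (real (num_targets k))\<^sup>2 / 4))"
      unfolding T by simp
  qed
  also have "\<dots> = (\<Sum>T\<in>?T. prob (?C T)) * exp (- (fast_prob k * (real (num_targets k))\<^sup>2 / 4))"
    by (simp add: sum_distrib_right)
  also have "(\<Sum>T\<in>?T. prob (?C T)) = prob (\<Union>T\<in>?T. ?C T)"
    using fin F by (intro finite_measure_finite_Union[symmetric]) (auto simp: disjoint_family_on_def)
  also have "\<dots> * exp (- (fast_prob k * (real (num_targets k))\<^sup>2 / 4)) \<le> 1 * exp (- (fast_prob k * (real (num_targets k))\<^sup>2 / 4))"
    by (intro mult_right_mono) auto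
  finally show "prob ?L \<le> exp (- (fast_prob k * (real (num_targets k))\<^sup>2 / 4))" by simp
qed

lemma linked_event: "v \<in> targets k u \<Longrightarrow> {s \<in> space M. linked k s u v} \<in> events"
  using linked_in_info[of v k u "inside (region k u)"] sets_info_le[OF inside_subset] by blast

lemma prob_few_hubs_le:
  assumes Q: "\<And>w'. w' \<in> targets k w \<Longrightarrow> prob {s \<in> space M. \<not> linked k s w w'} \<le> q"
  shows "{s \<in> space M. 2 * card (hubs k w s) < num_targets k} \<in> events" (is "?L \<in> _")
    and "prob {s \<in> space M. 2 * card (hubs k w s) < num_targets k} \<le> 4 * q + (1/2) ^ num_targets k"
proof -
  let ?S = "targets k w"
  let ?B = "\<lambda>w'. {s \<in> space M. \<not> linked k s w w'}"
  let ?B1 = "{s \<in> space M. real (card ?S) \<le> 4 * real (card {w' \<in> ?S. s \<in> ?B w'})}"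
  let ?B2 = "{s \<in> space M. real (card ?S) \<le> 4 * real (card {w' \<in> ?S. V w' s < v\<^sub>0})}"
  have "?B w' \<in> events" if "w' \<in> ?S" for w'
    using linked_event[OF that] by (intro sets.sets_Collect_neg)
  note B = this
  have "?S \<noteq> {}" using card_targets[of k w] rad_pos[of k] by (auto simp: num_targets_def)
  then have B1: "prob ?B1 \<le> 4 * q"
    using B Q by (intro prob_many_bad_le finite_targets) auto
  have B2: "prob ?B2 \<le> (1/2) ^ num_targets k"
    using prob_many_light_le[OF finite_targets few_light, of k w] by (simp add: card_targets)
  have count: "(\<lambda>s. real (card {x \<in> ?S. P x s})) \<in> borel_measurable M" if P: "\<And>x. x \<in> ?S \<Longrightarrow> {s \<in> space M. P x s} \<in> events" for P
  proof -
    have "real (card {x \<in> ?S. P x s}) = (\<Sum>x\<in>?S. indicator {s \<in> space M. P x s} s)" if "s \<in> space M" for s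
      using finite_targets[of k w] that by (simp add: indicator_def sum.If_cases Int_def)
    moreover have "(\<lambda>s. \<Sum>x\<in>?S. indicator {s \<in> space M. P x s} s :: real) \<in> borel_measurable M"
      using P by (intro borel_measurable_sum borel_measurable_indicator)
    ultimately show ?thesis by (simp cong: measurable_cong)
  qed
  have [measurable]: "(\<lambda>s. real (card (hubs k w s))) \<in> borel_measurable M"
    unfolding hubs_def using linked_event by (intro count sets.sets_Collect_conj) auto
  have "?L = {s \<in> space M. 2 * real (card (hubs k w s)) < real (num_targets k)}" by auto
  also have "\<dots> \<in> events" by measurable
  finally show "?L \<in> events" .
  have B1M: "?B1 \<in> events"
    using count[of "\<lambda>x s. s \<in> ?B x"] B by measurable
  have B2M: "?B2 \<in> events"
    using count[of "\<lambda>x s. V x s < v\<^sub>0"] by measurable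
  have "?L \<subseteq> ?B1 \<union> ?B2"
  proof
    fix s assume s: "s \<in> ?L"
    have "?S = hubs k w s \<union> ({w' \<in> ?S. s \<in> ?B w'} \<union> {w' \<in> ?S. V w' s < v\<^sub>0})"
      using s unfolding hubs_def by auto
    then have "card ?S = card (hubs k w s \<union> ({w' \<in> ?S. s \<in> ?B w'} \<union> {w' \<in> ?S. V w' s < v\<^sub>0}))"
      by (rule arg_cong)
    also have "\<dots> \<le> card (hubs k w s) + (card {w' \<in> ?S. s \<in> ?B w'} + card {w' \<in> ?S. V w' s < v\<^sub>0})"
      by (intro order_trans[OF card_Un_le] add_left_mono card_Un_le)
    finally show "s \<in> ?B1 \<union> ?B2" using s by (auto simp: card_targets)
  qed
  then have "prob ?L \<le> prob (?B1 \<union> ?B2)" by (intro finite_measure_mono sets.Un B1M B2M)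
  also have "\<dots> \<le> prob ?B1 + prob ?B2" by (intro measure_Un_le B1M B2M)
  finally show "prob ?L \<le> 4 * q + (1/2) ^ num_targets k" using B1 B2 by linarith
qed

text \<open>At each of the two ends, failure to have hubs at half of the candidates costs \<open>4 * q\<close> for linkage and
  \<open>(1 / 2) ^ num_targets k\<close> for heaviness. The failure set is covered by a measurable set, which gives
  the estimate at once for all \<open>u\<close> and \<open>v\<close> with disjoint cubes.\<close>

lemma not_linked_Suc_cover:
  assumes disj: "region k u \<inter> region k v = {}"
    and Q: "\<And>w w'. w' \<in> targets k w \<Longrightarrow> prob {s \<in> space M. \<not> linked k s w w'} \<le> q"
  shows "\<exists>N\<in>events. {s \<in> space M. \<not> linked (Suc k) s u v} \<subseteq> N \<and> prob N
     \<le> 8 * q + 2 * (1/2) ^ num_targets k + exp (- (fast_prob k * (real (num_targets k))\<^sup>2 / 4))"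
proof -
  let ?B = "\<lambda>w. {s \<in> space M. 2 * card (hubs k w s) < num_targets k}"
  let ?G = "{s \<in> space M. num_targets k \<le> 2 * card (hubs k u s) \<and> num_targets k \<le> 2 * card (hubs k v s) \<and>
      (\<forall>u'\<in>hubs k u s. \<forall>v'\<in>hubs k v s. reach k powr - \<alpha> < \<omega> {u', v'} s)}"
  have B: "?B w \<in> events" for w by (rule prob_few_hubs_le(1)[OF Q])
  note G = prob_no_bridge(1)[OF disj]
  have sub: "{s \<in> space M. \<not> linked (Suc k) s u v} \<subseteq> ?B u \<union> (?B v \<union> ?G)"
  proof
    fix s assume s: "s \<in> {s \<in> space M. \<not> linked (Suc k) s u v}"
    then have sM: "s \<in> space M" and not: "\<not> linked (Suc k) s u v" by blast+
    have "reach k powr - \<alpha> < \<omega> {u', v'} s" if "u' \<in> hubs k u s" "v' \<in> hubs k v s" for u' v'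
    proof (rule ccontr)
      assume "\<not> reach k powr - \<alpha> < \<omega> {u', v'} s"
      then have "linked (Suc k) s u v"
        unfolding linked.simps using that by (intro bexI[of _ u'] bexI[of _ v']) (auto simp: hubs_def)
      with not show False by blast
    qed
    with sM show "s \<in> ?B u \<union> (?B v \<union> ?G)" by (auto simp del: linked.simps)
  qed
  have "prob (?B u \<union> (?B v \<union> ?G)) \<le> prob (?B u) + (prob (?B v) + prob ?G)"
    using B G by (intro order_trans[OF measure_Un_le] add_left_mono) auto
  also have "\<dots> \<le> (4 * q + (1/2) ^ num_targets k) + ((4 * q + (1/2) ^ num_targets k) + exp (- (fast_prob k * (real (num_targets k))\<^sup>2 / 4)))"
    by (intro add_mono prob_few_hubs_le(2) prob_no_bridge(2) disj Q)
  finally have le: "prob (?B u \<union> (?B v \<union> ?G)) \<le> 8 * q + 2 * (1/2) ^ num_targets k + exp (- (fast_prob k * (real (num_targets k))\<^sup>2 / 4))"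
    by simp
  have ev: "?B u \<union> (?B v \<union> ?G) \<in> events" using B G by auto
  show "\<exists>N\<in>events. {s \<in> space M. \<not> linked (Suc k) s u v} \<subseteq> N \<and> prob N
     \<le> 8 * q + 2 * (1/2) ^ num_targets k + exp (- (fast_prob k * (real (num_targets k))\<^sup>2 / 4))"
    using ev sub le by blast
qed

section \<open>Summing the failure probabilities over the levels\<close>

text \<open>The first term covers the events of probability \<open>(1 / 2) ^ m\<close> with \<open>m \<ge> R\<close>, the second one the absence
  of a fast edge between the hubs; both are written in terms of the smallest scale, where they are largest.\<close>

definition err :: real where
  "err = exp (- (ln 2 * R)) +
     exp (- ((6 * real CARD('d)) powr - (\<alpha> * \<theta>) / 4 * R powr (2 * real CARD('d) - \<alpha> * \<theta> * b)))"

lemma half_power_le: "R \<le> real n \<Longrightarrow> (1/2) ^ n \<le> exp (- (ln 2 * R))"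
proof -
  assume "R \<le> real n"
  have "(1/2 :: real) ^ n = exp (real n * - ln 2)"
    by (subst exp_of_nat_mult) (simp add: exp_minus inverse_eq_divide)
  also have "\<dots> \<le> exp (- (ln 2 * R))" using \<open>R \<le> real n\<close> by (simp add: mult.commute)
  finally show ?thesis .
qed

lemma fast_pairs_ge:
  "(6 * real CARD('d)) powr - (\<alpha> * \<theta>) / 4 * R powr (2 * real CARD('d) - \<alpha> * \<theta> * b)
    \<le> fast_prob k * (real (num_targets k))\<^sup>2 / 4"
proof -
  have s: "0 < scale k" using scale_ge_1[of k] by simp
  have "6 * real CARD('d) * R \<le> reach k"
    unfolding reach_def scale_powr_b using scale_ge_R[of "Suc k"] by (intro mult_left_mono) auto
  from many_fast[OF this] have "(6 * real CARD('d) * scale k powr b) powr - (\<alpha> * \<theta>) \<le> fast_prob k"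
    unfolding fast_prob_def by (simp add: powr_powr reach_def)
  then have f: "(6 * real CARD('d)) powr - (\<alpha> * \<theta>) * scale k powr - (\<alpha> * \<theta> * b) \<le> fast_prob k"
    by (simp add: powr_mult powr_powr mult_ac)
  have "scale k powr (2 * real CARD('d)) = (scale k ^ CARD('d))\<^sup>2"
    using s by (simp add: powr_realpow[symmetric] powr_powr power2_eq_square powr_add[symmetric])
  also have "\<dots> \<le> (real (num_targets k))\<^sup>2"
    using num_targets_ge[of k] s by (intro power_mono) auto
  finally have n: "scale k powr (2 * real CARD('d)) \<le> (real (num_targets k))\<^sup>2" .
  have "R powr (2 * real CARD('d) - \<alpha> * \<theta> * b) \<le> scale k powr (2 * real CARD('d) - \<alpha> * \<theta> * b)"
    using b_upper R_ge_1 scale_ge_R by (intro powr_mono2) auto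
  also have "\<dots> = scale k powr - (\<alpha> * \<theta> * b) * scale k powr (2 * real CARD('d))"
    by (simp add: powr_add[symmetric])
  finally have "(6 * real CARD('d)) powr - (\<alpha> * \<theta>) * R powr (2 * real CARD('d) - \<alpha> * \<theta> * b)
     \<le> ((6 * real CARD('d)) powr - (\<alpha> * \<theta>) * scale k powr - (\<alpha> * \<theta> * b)) * scale k powr (2 * real CARD('d))"
    unfolding mult.assoc by (intro mult_left_mono) auto
  also have "\<dots> \<le> fast_prob k * (real (num_targets k))\<^sup>2"
    using f n by (intro mult_mono) (auto simp: fast_prob_def)
  finally show ?thesis by simp
qed

lemma level_error_le: "2 * (1/2) ^ num_targets k + exp (- (fast_prob k * (real (num_targets k))\<^sup>2 / 4)) \<le> 2 * err"
proof -
  have "R \<le> scale k" by (rule scale_ge_R)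
  also have "\<dots> \<le> scale k ^ CARD('d)" using scale_ge_1[of k] by (intro self_le_power) auto
  also have "\<dots> \<le> real (num_targets k)" by (rule num_targets_ge)
  finally have "(1/2) ^ num_targets k \<le> exp (- (ln 2 * R))" by (rule half_power_le)
  moreover have "exp (- (fast_prob k * (real (num_targets k))\<^sup>2 / 4))
     \<le> exp (- ((6 * real CARD('d)) powr - (\<alpha> * \<theta>) / 4 * R powr (2 * real CARD('d) - \<alpha> * \<theta> * b)))" (is "_ \<le> ?e")
    using fast_pairs_ge[of k] by simp
  moreover have "2 * a + c \<le> 2 * (x + y)" if "a \<le> x" "c \<le> y" "0 \<le> y" for a c x y :: real
    using that by argo
  ultimately show ?thesis unfolding err_def by (meson exp_ge_zero)
qed

lemma err_nonneg: "0 \<le> err"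
  unfolding err_def by (intro add_nonneg_nonneg) auto

text \<open>Solves the recursion \<open>q (k + 1) \<le> 8 * q k + 2 * err\<close> with \<open>q 0 \<le> err\<close>.\<close>

lemma prob_not_linked:
  "v \<in> targets k u \<Longrightarrow> prob {s \<in> space M. \<not> linked k s u v} \<le> (2 * 8 ^ k - 1) * err"
proof (induction k arbitrary: u v)
  case 0
  have "R \<le> real (nat (rad 0))" using rad_ge_scale[of 0] rad_pos[of 0] by (simp add: scale_0)
  then have "(1/2) ^ nat (rad 0) \<le> exp (- (ln 2 * R))" by (rule half_power_le)
  then have "(1/2) ^ nat (rad 0) \<le> err" unfolding err_def by (simp add: add_increasing2)
  with prob_not_linked_0[OF 0] show ?case by simp
next
  case (Suc k)
  obtain N where N: "N \<in> events" "{s \<in> space M. \<not> linked (Suc k) s u v} \<subseteq> N"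
    "prob N \<le> 8 * ((2 * 8 ^ k - 1) * err) + 2 * (1/2) ^ num_targets k
      + exp (- (fast_prob k * (real (num_targets k))\<^sup>2 / 4))"
    using not_linked_Suc_cover[OF region_split(3)[OF Suc.prems] Suc.IH] by blast
  have "prob {s \<in> space M. \<not> linked (Suc k) s u v} \<le> prob N"
    using N(1,2) by (intro finite_measure_mono)
  also note N(3)
  also have "8 * ((2 * 8 ^ k - 1) * err) + 2 * (1/2) ^ num_targets k
      + exp (- (fast_prob k * (real (num_targets k))\<^sup>2 / 4)) \<le> 8 * ((2 * 8 ^ k - 1) * err) + 2 * err"
    using level_error_le[of k] by simp
  also have "\<dots> \<le> (2 * 8 ^ Suc k - 1) * err"
    using err_nonneg by (simp add: algebra_simps)
  finally show ?case .
qed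

lemma prob_passage_time_gt_le:
  assumes disj: "region k u \<inter> region k v = {}"
    and near: "\<And>u' v'. u' \<in> targets k u \<Longrightarrow> v' \<in> targets k v \<Longrightarrow> l1_norm (u' - v') \<le> reach k"
    and m: "0 < m" "m \<le> v\<^sub>0"
    and c: "3 * 2 ^ Suc k * edge_cost m \<le> c"
  shows "prob {s \<in> space M. passage_time \<alpha> V \<omega> s u v > ereal c}
    \<le> 2 * 8 ^ Suc k * err + 2 * measure \<mu> {..<m}"
proof -
  obtain N where N: "N \<in> events" "{s \<in> space M. \<not> linked (Suc k) s u v} \<subseteq> N"
    "prob N \<le> 8 * ((2 * 8 ^ k - 1) * err) + 2 * (1/2) ^ num_targets k + exp (- (fast_prob k * (real (num_targets k))\<^sup>2 / 4))"
    using not_linked_Suc_cover[OF disj prob_not_linked] by blast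
  have PN: "prob N \<le> 2 * 8 ^ Suc k * err"
    using N(3) level_error_le[of k] err_nonneg by (simp add: algebra_simps)
  let ?L = "\<lambda>w. {s \<in> space M. V w s \<in> {..<m}}"
  have sub: "{s \<in> space M. passage_time \<alpha> V \<omega> s u v > ereal c} \<subseteq> N \<union> (?L u \<union> ?L v)"
  proof
    fix s assume s: "s \<in> {s \<in> space M. passage_time \<alpha> V \<omega> s u v > ereal c}"
    show "s \<in> N \<union> (?L u \<union> ?L v)"
    proof (rule ccontr)
      assume not: "s \<notin> N \<union> (?L u \<union> ?L v)"
      have "passage_time \<alpha> V \<omega> s u v \<le> ereal (3 * 2 ^ Suc k * edge_cost m)"
        using not s N(2) m disj near by (intro passage_time_le) auto
      also have "\<dots> \<le> ereal c" using c by simp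
      finally show False using s by auto
    qed
  qed
  have "prob {s \<in> space M. passage_time \<alpha> V \<omega> s u v > ereal c} \<le> prob (N \<union> (?L u \<union> ?L v))"
    using N(1) by (intro finite_measure_mono sub) auto
  also have "\<dots> \<le> prob N + (prob (?L u) + prob (?L v))"
    using N(1) by (intro order_trans[OF measure_Un_le] add_left_mono) auto
  finally show ?thesis using PN prob_V[of "{..<m}"] by simp
qed

lemma regions_disjoint_far:
  assumes "3 * rad k < \<bar>v $ i - u $ i\<bar>"
  shows "region k u \<inter> region k v = {}"
proof (rule ccontr)
  assume "region k u \<inter> region k v \<noteq> {}"
  then obtain w where "w $ i \<in> {u $ i .. u $ i + 3 * rad k}" "w $ i \<in> {v $ i .. v $ i + 3 * rad k}"
    unfolding region_def by blast
  with assms show False by auto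
qed

lemma l1_norm_top_le:
  assumes "\<And>i. \<bar>v $ i - u $ i\<bar> \<le> h" "real_of_int h \<le> scale k powr b" "u' \<in> targets k u" "v' \<in> targets k v"
  shows "l1_norm (u' - v') \<le> reach k"
proof -
  have "\<bar>real_of_int ((u' - v') $ i)\<bar> \<le> 6 * scale k powr b" for i
  proof -
    have "u' $ i \<in> {u $ i + rad k <.. u $ i + 2 * rad k}" "v' $ i \<in> {v $ i + rad k <.. v $ i + 2 * rad k}"
      using assms(3,4) unfolding targets_def by blast+
    then have "\<bar>(u' - v') $ i\<bar> \<le> h + rad k" using assms(1)[of i] by auto
    then have "\<bar>real_of_int ((u' - v') $ i)\<bar> \<le> real_of_int h + real_of_int (rad k)" by linarith
    also have "\<dots> \<le> scale k powr b + 2 * scale k" using assms(2) rad_le_scale[of k] by simp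
    also have "\<dots> \<le> 6 * scale k powr b"
      using scale_Suc_ge[of k] scale_ge_1[of k] by (simp add: scale_powr_b)
    finally show ?thesis .
  qed
  from l1_norm_le[OF this] show ?thesis unfolding reach_def by simp
qed

text \<open>With \<open>l = ln n\<close>: the end vertices are only required to have weight at least \<open>l powr - e\<close>, a bound that tends to \<open>0\<close>
  and therefore is met with probability tending to \<open>1\<close>; for small \<open>e\<close> its price is a small power of \<open>l\<close>.\<close>

lemma edge_cost_le:
  assumes "1 \<le> l" "0 \<le> e" "R \<le> l powr (b * e)"
  shows "edge_cost (l powr - e) \<le> (4 * real CARD('d)) powr \<alpha> * t * l powr (e * (\<alpha> * b + 2))"
proof -
  have "real_of_int (rad 0) \<le> 2 * l powr (b * e)"
    using rad_le_scale[of 0] assms by (simp add: scale_0)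
  then have "(2 * real CARD('d) * real_of_int (rad 0)) powr \<alpha> \<le> (4 * real CARD('d) * l powr (b * e)) powr \<alpha>"
    using rad_pos[of 0] alpha_pos by (intro powr_mono2) auto
  also have "\<dots> = (4 * real CARD('d)) powr \<alpha> * l powr (e * \<alpha> * b)"
    by (simp add: powr_mult powr_powr mult_ac)
  finally have A: "(2 * real CARD('d) * real_of_int (rad 0)) powr \<alpha>
      \<le> (4 * real CARD('d)) powr \<alpha> * l powr (e * \<alpha> * b)" .
  have "edge_cost (l powr - e) = (2 * real CARD('d) * real_of_int (rad 0)) powr \<alpha> * t / l powr - (2 * e)"
    unfolding edge_cost_def by (simp add: power2_eq_square powr_add[symmetric])
  also have "\<dots> = (2 * real CARD('d) * real_of_int (rad 0)) powr \<alpha> * (t * l powr (2 * e))"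
    by (simp only: powr_minus divide_inverse inverse_inverse_eq mult.assoc)
  also have "\<dots> \<le> ((4 * real CARD('d)) powr \<alpha> * l powr (e * \<alpha> * b)) * (t * l powr (2 * e))"
    using A t_ge_1 by (intro mult_right_mono) auto
  also have "\<dots> = (4 * real CARD('d)) powr \<alpha> * t * l powr (e * \<alpha> * b + 2 * e)"
    by (simp only: powr_add mult_ac)
  also have "e * \<alpha> * b + 2 * e = e * (\<alpha> * b + 2)" by (simp add: algebra_simps)
  finally show ?thesis .
qed

lemma err_le:
  assumes "1 \<le> l" "l powr e \<le> R"
  shows "err \<le> exp (- (ln 2 * l powr e)) + exp (- ((6 * real CARD('d)) powr - (\<alpha> * \<theta>) / 4 * l powr (e * (2 * real CARD('d) - \<alpha> * \<theta> * b))))"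
proof -
  have "l powr (e * (2 * real CARD('d) - \<alpha> * \<theta> * b)) = (l powr e) powr (2 * real CARD('d) - \<alpha> * \<theta> * b)"
    by (simp add: powr_powr)
  also have "\<dots> \<le> R powr (2 * real CARD('d) - \<alpha> * \<theta> * b)"
    using assms b_upper by (intro powr_mono2) auto
  finally have "(6 * real CARD('d)) powr - (\<alpha> * \<theta>) / 4 * l powr (e * (2 * real CARD('d) - \<alpha> * \<theta> * b))
     \<le> (6 * real CARD('d)) powr - (\<alpha> * \<theta>) / 4 * R powr (2 * real CARD('d) - \<alpha> * \<theta> * b)"
    by (intro mult_left_mono) auto
  then show ?thesis unfolding err_def using assms(2) by (intro add_mono) auto
qed

text \<open>Applied with \<open>q = 2\<close> to the number of edges of the path and with \<open>q = 8\<close> to the accumulated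
  failure probability.\<close>

lemma level_count_powr_le:
  assumes "b ^ k \<le> l" "1 < q"
  shows "q ^ k \<le> l powr (ln q / ln b)"
proof -
  have b: "0 < ln b" "0 < ln q" using b_gt_1 assms(2) by auto
  have "q ^ k = exp (real k * ln q)" using assms(2) by (simp add: exp_of_nat_mult)
  also have "\<dots> = exp ((ln q / ln b) * (real k * ln b))" using b by simp
  also have "\<dots> = (b ^ k) powr (ln q / ln b)"
    using b_gt_1 by (simp add: powr_def ln_realpow)
  also have "\<dots> \<le> l powr (ln q / ln b)"
    using assms b b_gt_1 by (intro powr_mono2) auto
  finally show ?thesis .
qed

text \<open>The hypothesis \<open>far\<close> makes the two top-level cubes disjoint: their side is
  \<open>3 * rad k \<le> 6 * scale k = 6 * real n powr (1 / b)\<close>.\<close>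

lemma prob_passage_time_log_le:
  fixes n :: nat and x :: "real ^ 'd"
  defines "l \<equiv> ln (real n)" and "y \<equiv> ceil_vec (real n *\<^sub>R x)"
  assumes "1 \<le> l" "0 < e" and levels: "b ^ Suc k \<le> l" and R: "R = exp (l / b ^ Suc k)" "l powr e \<le> R" "R \<le> l powr (b * e)"
    and v: "l powr - e \<le> v\<^sub>0" and x: "infnorm x \<le> 1"
    and far: "6 * real n powr (1 / b) < \<bar>real_of_int (y $ i)\<bar>"
  shows "prob {s \<in> space M. passage_time \<alpha> V \<omega> s 0 y
      > ereal (3 * (4 * real CARD('d)) powr \<alpha> * t * l powr (ln 2 / ln b + e * (\<alpha> * b + 2)))}
    \<le> 2 * (l powr (ln 8 / ln b) * (exp (- (ln 2 * l powr e))
         + exp (- ((6 * real CARD('d)) powr - (\<alpha> * \<theta>) / 4 * l powr (e * (2 * real CARD('d) - \<alpha> * \<theta> * b))))))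
      + 2 * measure \<mu> {..<l powr - e}"
proof -
  have n: "0 < real n" using \<open>1 \<le> l\<close> unfolding l_def by (cases n) auto
  \<comment> \<open>the base scale is adjusted so that the top level bridges exactly the distance \<open>n\<close>\<close>
  have top: "scale k powr b = real n"
  proof -
    have "scale k powr b = R powr (b ^ Suc k)" by (simp only: scale_powr_b) (simp only: scale_def)
    also have "\<dots> = exp l" unfolding R powr_def using b_gt_1 by simp
    finally show ?thesis using n by (simp add: l_def)
  qed
  then have "scale k = real n powr (1 / b)"
    using scale_ge_1[of k] b_gt_1 by (metis powr_powr mult.commute nonzero_eq_divide_eq powr_one less_eq_real_def not_one_less_zero order_trans zero_le_one)
  then have "3 * real_of_int (rad k) < \<bar>real_of_int (y $ i)\<bar>"
    using far rad_le_scale[of k] by linarith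
  then have "3 * rad k < \<bar>y $ i - 0 $ i\<bar>" by simp
  then have disj: "region k 0 \<inter> region k y = {}" by (rule regions_disjoint_far)
  have near: "l1_norm (u' - v') \<le> reach k" if "u' \<in> targets k 0" "v' \<in> targets k y" for u' v'
    using ceil_vec_le[OF x, of n] top that by (intro l1_norm_top_le[of y 0 "int n"]) (auto simp: y_def)
  have "3 * 2 ^ Suc k * edge_cost (l powr - e)
      \<le> 3 * l powr (ln 2 / ln b) * ((4 * real CARD('d)) powr \<alpha> * t * l powr (e * (\<alpha> * b + 2)))"
    using \<open>1 \<le> l\<close> \<open>0 < e\<close> R(3) level_count_powr_le[OF levels, of 2] edge_cost_nonneg
    by (intro mult_mono edge_cost_le) auto
  also have "\<dots> = 3 * (4 * real CARD('d)) powr \<alpha> * t * l powr (ln 2 / ln b + e * (\<alpha> * b + 2))"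
    by (simp add: powr_add mult_ac)
  finally have cost: "3 * 2 ^ Suc k * edge_cost (l powr - e) \<le> 3 * (4 * real CARD('d)) powr \<alpha> * t * l powr (ln 2 / ln b + e * (\<alpha> * b + 2))" .
  have P: "prob {s \<in> space M. passage_time \<alpha> V \<omega> s 0 y
      > ereal (3 * (4 * real CARD('d)) powr \<alpha> * t * l powr (ln 2 / ln b + e * (\<alpha> * b + 2)))}
     \<le> 2 * 8 ^ Suc k * err + 2 * measure \<mu> {..<l powr - e}"
    using disj near v cost \<open>1 \<le> l\<close> by (intro prob_passage_time_gt_le[of k]) auto
  have "8 ^ Suc k * err \<le> l powr (ln 8 / ln b) * (exp (- (ln 2 * l powr e))
         + exp (- ((6 * real CARD('d)) powr - (\<alpha> * \<theta>) / 4 * l powr (e * (2 * real CARD('d) - \<alpha> * \<theta> * b)))))"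
    using level_count_powr_le[OF levels, of 8] err_nonneg \<open>1 \<le> l\<close> R(2) by (intro mult_mono err_le) auto
  from P mult_left_mono[OF this, of 2] show ?thesis by (simp add: mult.assoc del: power_Suc)
qed

end

section \<open>Choice of the number of levels\<close>

text \<open>The number of levels is the largest one for which the base scale \<open>exp (L / b ^ Suc k)\<close> is still at least
  \<open>L powr e\<close>; by maximality it is then at most \<open>L powr (b * e)\<close>.\<close>

lemma levels_choice:
  fixes b e :: real
  assumes "1 < b" "0 < e"
  shows "\<forall>\<^sub>F L in at_top. \<exists>k::nat. b ^ Suc k \<le> L \<and> L powr e \<le> exp (L / b ^ Suc k)
     \<and> exp (L / b ^ Suc k) \<le> L powr (b * e)"
proof -
  have "\<forall>\<^sub>F L in at_top. 1 \<le> e * ln L" using assms(2) by real_asymp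
  moreover have "\<forall>\<^sub>F L in at_top. b \<le> L / (e * ln L)" using assms(2) by real_asymp
  moreover have "\<forall>\<^sub>F L in at_top. (1::real) < L" by (rule eventually_gt_at_top)
  ultimately show ?thesis
  proof eventually_elim
    case (elim L)
    define x where "x = L / (e * ln L)"
    have x: "b \<le> x" "0 < x" using elim assms by (auto simp: x_def)
    have "1 \<le> \<lfloor>log b x\<rfloor>" using x assms by (simp add: le_floor_iff le_log_iff)
    then obtain k where k: "\<lfloor>log b x\<rfloor> = int (Suc k)"
      by (intro that[of "nat \<lfloor>log b x\<rfloor> - 1"]) simp
    have "real (Suc k) \<le> log b x" "log b x < real (Suc k) + 1" using k by linarith+
    then have "b powr real (Suc k) \<le> x" "x < b powr (real (Suc k) + 1)"
      using assms x by (simp_all add: le_log_iff log_less_iff)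
    then have lo: "b ^ Suc k \<le> x" and hi: "x < b * b ^ Suc k"
      using assms by (simp_all only: powr_add powr_realpow) (simp_all add: mult_ac)
    have el: "0 < e * ln L" using elim by simp
    have bk: "0 < b ^ Suc k" using assms by simp
    have "b ^ Suc k \<le> L"
      using lo elim divide_left_mono[of 1 "e * ln L" L] by (simp add: x_def)
    moreover have "e * ln L \<le> L / b ^ Suc k"
      using lo el bk unfolding x_def by (simp add: field_simps del: power_Suc)
    then have "L powr e \<le> exp (L / b ^ Suc k)" using elim by (simp add: powr_def)
    moreover have "L / b ^ Suc k \<le> b * e * ln L"
      using hi el bk unfolding x_def by (simp add: field_simps del: power_Suc)
    then have "exp (L / b ^ Suc k) \<le> L powr (b * e)" using elim by (simp add: powr_def)
    ultimately show ?case by (intro exI[of _ k] conjI)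
  qed
qed

lemma powr_times_exp_tendsto_0:
  fixes a c p :: real
  assumes "0 < c" "0 < p"
  shows "((\<lambda>L. L powr a * exp (- (c * L powr p))) \<longlongrightarrow> 0) at_top"
proof -
  have "((\<lambda>u. u powr (a / p) * exp (- (c * u))) \<longlongrightarrow> 0) at_top"
    using assms(1) by real_asymp
  moreover have "filterlim (\<lambda>L::real. L powr p) at_top at_top"
    using assms(2) by real_asymp
  ultimately have "((\<lambda>L. (L powr p) powr (a / p) * exp (- (c * L powr p))) \<longlongrightarrow> 0) at_top"
    by (rule filterlim_compose)
  then show ?thesis using assms(2) by (simp add: powr_powr)
qed

lemma ceil_vec_far:
  fixes x :: "real ^ 'd::finite"
  assumes "x $ i \<noteq> 0" "1 < b"
  shows "\<forall>\<^sub>F n in sequentially. 6 * real n powr (1 / b) < \<bar>real_of_int (ceil_vec (real n *\<^sub>R x) $ i)\<bar>"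
proof -
  define c where "c = \<bar>x $ i\<bar>"
  have "0 < c" using assms by (simp add: c_def)
  moreover have "1 / b < 1" using assms by simp
  ultimately have "\<forall>\<^sub>F n in sequentially. 6 * real n powr (1 / b) < real n * c - 1"
    by real_asymp
  then show ?thesis
  proof eventually_elim
    case (elim n)
    have "real n * c - 1 \<le> \<bar>real_of_int \<lceil>real n * x $ i\<rceil>\<bar>"
    proof -
      have "real n * c = \<bar>real n * x $ i\<bar>" unfolding c_def by (simp add: abs_mult)
      then show ?thesis by linarith
    qed
    with elim show ?case by (simp add: ceil_vec_nth)
  qed
qed

section \<open>The polylogarithmic upper bound\<close>

theorem theorem3p3:
  fixes M :: "'s measure"
    and V :: "'d::finite site \<Rightarrow> 's \<Rightarrow> real"
    and \<omega> :: "'d site set \<Rightarrow> 's \<Rightarrow> real"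
    and \<mu> \<nu> :: "real measure"
    and \<alpha> \<gamma> \<theta> \<zeta> d \<Delta> :: real
    and x :: "real ^ 'd"
  assumes model: "ilrfpp_standing M V \<omega> \<mu> \<nu> \<alpha> \<gamma> \<theta> \<zeta>"
    and d_def: "d = real CARD('d)"
    and alpha_lower: "d / \<theta> < \<alpha>" and alpha_upper: "\<alpha> < 2 * d / \<theta>"
    and alpha_gamma: "\<alpha> > 2 * d / \<gamma>"
    and Delta_def: "\<Delta> = ln 2 / ln (2 * d / (\<alpha> * \<theta>))"
    and x_le: "infnorm x \<le> 1" and x_nz: "x \<noteq> 0"
  shows "\<Delta> > 1 \<and>
    (\<forall>\<epsilon>>0. \<exists>C::real.
      (\<lambda>n::nat. measure M {s \<in> space M.
          passage_time \<alpha> V \<omega> s 0 (ceil_vec (real n *\<^sub>R x))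
            > ereal (C * ln (real n) powr (\<Delta> + \<epsilon>))})
      \<longlonglongrightarrow> 0)"
proof -
  interpret ilrfpp_standing M V \<omega> \<mu> \<nu> \<alpha> \<gamma> \<theta> \<zeta> by (rule model)
  define q where "q = 2 * d / (\<alpha> * \<theta>)"
  have d_pos: "0 < d" unfolding d_def by simp
  have at: "0 < \<alpha> * \<theta>" using alpha_pos theta_pos by simp
  have q: "1 < q" "q < 2"
    using alpha_lower alpha_upper alpha_pos theta_pos d_pos at by (simp_all add: q_def field_simps)
  have lnq: "0 < ln q" "ln q < ln 2" using q by simp_all
  have \<Delta>: "\<Delta> = ln 2 / ln q" unfolding Delta_def q_def ..
  have \<Delta>1: "1 < \<Delta>" unfolding \<Delta> using lnq by simp
  show ?thesis
  proof (intro conjI \<Delta>1 allI impI)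
    fix \<epsilon> :: real assume \<epsilon>: "0 < \<epsilon>"
    \<comment> \<open>chosen such that \<open>ln 2 / ln b = \<Delta> + \<epsilon> / 2\<close>, with the other half of \<open>\<epsilon>\<close> left for \<open>edge_cost\<close>\<close>
    define b where "b = q powr (\<Delta> / (\<Delta> + \<epsilon> / 2))"
    have r: "0 < \<Delta> / (\<Delta> + \<epsilon> / 2)" "\<Delta> / (\<Delta> + \<epsilon> / 2) < 1" using \<Delta>1 \<epsilon> by simp_all
    have b: "1 < b" unfolding b_def using q(1) r(1) by simp
    have bq: "b < q"
      unfolding b_def using q(1) r(2) powr_less_mono[of "\<Delta> / (\<Delta> + \<epsilon> / 2)" 1 q] by simp
    have lnb: "ln 2 / ln b = \<Delta> + \<epsilon> / 2"
      unfolding b_def using q(1) \<Delta>1 \<epsilon> lnq by (simp add: ln_powr \<Delta> field_simps)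
    define e where "e = \<epsilon> / 2 / (\<alpha> * b + 2)"
    have ab: "0 < \<alpha> * b + 2" using alpha_pos b by (simp add: add_pos_pos)
    have e: "0 < e" unfolding e_def using \<epsilon> ab by simp
    have "e * (\<alpha> * b + 2) = \<epsilon> / 2"
      unfolding e_def using ab by (intro nonzero_eq_divide_eq[THEN iffD1]) auto
    then have expo: "ln 2 / ln b + e * (\<alpha> * b + 2) = \<Delta> + \<epsilon>"
      unfolding lnb by simp
    have "\<theta> < 2 * d / (\<alpha> * b)"
      using bq alpha_pos b theta_pos by (simp add: q_def field_simps)
    then obtain \<theta>' where \<theta>': "\<theta> < \<theta>'" "\<theta>' < 2 * d / (\<alpha> * b)" using dense by blast
    have bu: "\<alpha> * \<theta>' * b < 2 * real CARD('d)"
      using \<theta>'(2) alpha_pos b by (simp add: d_def field_simps)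
    obtain t where t: "1 \<le> t" "measure \<nu> {t<..} \<le> 1 / 8" using nu_tail by blast
    have "\<forall>\<^sub>F v in at_right 0. measure \<mu> {..<v} < 1/256 \<and> 0 < v"
      using order_tendstoD(2)[OF mu_near_0[OF V_pos], of "1/256"] eventually_at_right_less
      by (intro eventually_conj) auto
    then obtain v\<^sub>0 where "measure \<mu> {..<v\<^sub>0} < 1/256 \<and> 0 < v\<^sub>0"
      using eventually_happens trivial_limit_at_right_real by blast
    then have v\<^sub>0: "0 < v\<^sub>0" "measure \<mu> {..<v\<^sub>0} \<le> 1 / 256" by simp_all
    obtain x\<^sub>0 where x\<^sub>0: "0 < x\<^sub>0" "\<And>x. 0 < x \<Longrightarrow> x < x\<^sub>0 \<Longrightarrow> x powr \<theta>' \<le> measure \<nu> {..x}"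
      using omega_power_lower[OF \<theta>'(1)] unfolding eventually_at_right_field by auto
    have large: "\<forall>\<^sub>F R in at_top. 1 \<le> R \<and> 6 \<le> R powr (b - 1) \<and> R powr - \<alpha> < x\<^sub>0"
      using b alpha_pos x\<^sub>0(1) by (intro eventually_conj; real_asymp)
    have hier: "hierarchy M V \<omega> \<mu> \<nu> \<alpha> v\<^sub>0 t \<theta>' b R"
      if R: "1 \<le> R" "6 \<le> R powr (b - 1)" "R powr - \<alpha> < x\<^sub>0" for R
    proof unfold_locales
      fix z assume z: "6 * real CARD('d) * R \<le> z"
      have "1 \<le> real CARD('d)" by (simp add: Suc_le_eq)
      then have "1 \<le> 6 * real CARD('d)" by linarith
      then have "1 * R \<le> 6 * real CARD('d) * R" using R(1) by (intro mult_right_mono) linarith+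
      with z have "R \<le> z" by simp
      then have "z powr - \<alpha> \<le> R powr - \<alpha>" using R(1) alpha_pos by (intro powr_mono2') auto
      then show "(z powr - \<alpha>) powr \<theta>' \<le> measure \<nu> {..z powr - \<alpha>}"
        using R \<open>R \<le> z\<close> by (intro x\<^sub>0(2)) auto
    qed (use R v\<^sub>0 t b bu theta_pos \<theta>' in auto)
    define \<kappa> where "\<kappa> = (6 * real CARD('d)) powr - (\<alpha> * \<theta>') / 4"
    define p where "p = e * (2 * real CARD('d) - \<alpha> * \<theta>' * b)"
    have \<kappa>: "0 < \<kappa>" unfolding \<kappa>_def by simp
    have p: "0 < p" unfolding p_def using e bu by simp
    \<comment> \<open>the bound of \<open>prob_passage_time_log_le\<close> as a function of \<open>l = ln n\<close>\<close>
    define g where "g l = 2 * (l powr (ln 8 / ln b) * (exp (- (ln 2 * l powr e)) + exp (- (\<kappa> * l powr p))))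
        + 2 * measure \<mu> {..<l powr - e}" for l :: real
    have "((\<lambda>l. measure \<mu> {..<l powr - e}) \<longlongrightarrow> 0) at_top"
    proof (rule filterlim_compose[OF mu_near_0[OF V_pos]])
      show "filterlim (\<lambda>l. l powr - e) (at_right 0) at_top" using e by real_asymp
    qed
    then have "(g \<longlongrightarrow> 2 * (0 + 0) + 2 * 0) at_top"
      unfolding g_def distrib_left[of "_ powr _"] using \<kappa> p e
      by (intro tendsto_add tendsto_mult tendsto_const powr_times_exp_tendsto_0) auto
    then have "(g \<longlongrightarrow> 0) at_top" by simp
    moreover have lnn: "filterlim (\<lambda>n::nat. ln (real n)) at_top sequentially" by real_asymp
    ultimately have g0: "(\<lambda>n. g (ln (real n))) \<longlonglongrightarrow> 0" by (rule filterlim_compose)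
    obtain i where i: "x $ i \<noteq> 0" using x_nz by (auto simp: vec_eq_iff)
    define C where "C = 3 * (4 * real CARD('d)) powr \<alpha> * t"
    have bound: "\<forall>\<^sub>F n in sequentially. prob {s \<in> space M.
          passage_time \<alpha> V \<omega> s 0 (ceil_vec (real n *\<^sub>R x)) > ereal (C * ln (real n) powr (\<Delta> + \<epsilon>))} \<le> g (ln (real n))"
    proof -
      have "filterlim (\<lambda>l::real. l powr e) at_top at_top" using e by real_asymp
      then have "\<forall>\<^sub>F l in at_top. \<forall>R\<ge>l powr e. 1 \<le> R \<and> 6 \<le> R powr (b - 1) \<and> R powr - \<alpha> < x\<^sub>0"
        using eventually_all_ge_at_top[OF large] unfolding filterlim_iff by blast
      moreover have "\<forall>\<^sub>F l in at_top. l powr - e < v\<^sub>0" using e v\<^sub>0(1) by real_asymp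
      moreover note levels_choice[OF b e] eventually_ge_at_top[of "1::real"]
      ultimately have "\<forall>\<^sub>F l in at_top. (\<forall>R\<ge>l powr e. 1 \<le> R \<and> 6 \<le> R powr (b - 1) \<and> R powr - \<alpha> < x\<^sub>0) \<and> l powr - e < v\<^sub>0
        \<and> (\<exists>k::nat. b ^ Suc k \<le> l \<and> l powr e \<le> exp (l / b ^ Suc k) \<and> exp (l / b ^ Suc k) \<le> l powr (b * e)) \<and> 1 \<le> l"
        by (intro eventually_conj)
      from filterlim_iff[THEN iffD1, OF lnn, rule_format, OF this] ceil_vec_far[OF i b]
      show ?thesis
      proof eventually_elim
        case (elim n)
        define l where "l = ln (real n)"
        obtain k :: nat where k: "b ^ Suc k \<le> l" "l powr e \<le> exp (l / b ^ Suc k)" "exp (l / b ^ Suc k) \<le> l powr (b * e)"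
          using elim(1) unfolding l_def by blast
        interpret hierarchy M V \<omega> \<mu> \<nu> \<alpha> v\<^sub>0 t \<theta>' b "exp (l / b ^ Suc k)"
          using elim(1) k(2) unfolding l_def by (intro hier) blast+
        have "l powr - e \<le> v\<^sub>0" "1 \<le> l" using elim(1) unfolding l_def by auto
        then show ?case
          using prob_passage_time_log_le[of n e k x i] k e elim(2) x_le
          unfolding expo C_def g_def \<kappa>_def p_def l_def by simp
      qed
    qed
    have "(\<lambda>n::nat. measure M {s \<in> space M.
          passage_time \<alpha> V \<omega> s 0 (ceil_vec (real n *\<^sub>R x)) > ereal (C * ln (real n) powr (\<Delta> + \<epsilon>))}) \<longlonglongrightarrow> 0"
      by (rule tendsto_sandwich[OF _ bound tendsto_const g0]) simp
    then show "\<exists>C::real. (\<lambda>n::nat. measure M {s \<in> space M.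
          passage_time \<alpha> V \<omega> s 0 (ceil_vec (real n *\<^sub>R x)) > ereal (C * ln (real n) powr (\<Delta> + \<epsilon>))}) \<longlonglongrightarrow> 0"
      by blast
  qed
qed

end
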